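(* Let $C\subset\mathbb P^2$ be an irreducible plane curve and let $B$ be a Cremona minimal model of $C$. Then $B$ is of one of the following types: (i) $B$ is a line; (ii) if $B$ has degree $d$ and points of multiplicities $m_1,\ldots,m_r$ with $m_1\geqslant\cdots\geqslant m_r$, then $d\geqslant m_1+m_2+m_3$; (iii) $B$ is a curve of degree $d$ with a point $p$ of maximal multiplicity $m_0$, and all points of $B$ of multiplicity $\mu\geqslant (d-m_0)/2$ are infinitely near to $p$.
   Context: We work over $\mathbb C$. A plane curve $B$ is Cremona equivalent to the irreducible plane curve $C$ if there is a birational map $\phi:\mathbb P^2\dashrightarrow\mathbb P^2$, not contracting $C$, such that $B$ is the closure of the image of $C$ (the proper image), and symmetrically $C$ is the proper image of $B$ under $\phi^{-1}$. A Cremona minimal model of $C$ is a plane curve which is Cremona equivalent to $C$ and has minimal degree among all plane curves Cremona equivalent to $C$. "Points" of a curve include infinitely near points (points on successive blow-ups of the surface), the multiplicity at an infinitely near point being that of the strict transform; multiplicities $m_i$ with $i$ larger than the number $r$ of listed points are taken to be $0$. *)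

theory Defs
  imports "HOL-Analysis.Analysis" "HOL-Computational_Algebra.Computational_Algebra"
begin

section \<open>Forms in three variables\<close>

text \<open>A polynomial in \<open>x, y, z\<close> is a nested univariate polynomial; \<open>x\<close> is the outermost and
  \<open>z\<close> the innermost variable.\<close>

type_synonym poly3 = "complex poly poly poly"
type_synonym poly2 = "complex poly poly"

definition coeff3 :: "poly3 \<Rightarrow> nat \<Rightarrow> nat \<Rightarrow> nat \<Rightarrow> complex" where
  "coeff3 F i j k = coeff (coeff (coeff F i) j) k"

definition homogeneous :: "nat \<Rightarrow> poly3 \<Rightarrow> bool" where
  "homogeneous d F \<longleftrightarrow> (\<forall>i j k. coeff3 F i j k \<noteq> 0 \<longrightarrow> i + j + k = d)"

text \<open>Value of \<open>F\<close> at a triple of elements of a commutative \<open>\<complex>\<close>-algebra with structure map \<open>\<iota>\<close>.\<close>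

definition eval3 :: "(complex \<Rightarrow> 'r::comm_ring_1) \<Rightarrow> poly3 \<Rightarrow> 'r ^ 3 \<Rightarrow> 'r" where
  "eval3 \<iota> F a =
     (\<Sum>i\<le>degree F. \<Sum>j\<le>degree (coeff F i). \<Sum>k\<le>degree (coeff (coeff F i) j).
        \<iota> (coeff3 F i j k) * a $ 1 ^ i * a $ 2 ^ j * a $ 3 ^ k)"

abbreviation value_at :: "poly3 \<Rightarrow> complex ^ 3 \<Rightarrow> complex" where
  "value_at F v \<equiv> eval3 (\<lambda>c. c) F v"

abbreviation subst3 :: "poly3 \<Rightarrow> poly3 ^ 3 \<Rightarrow> poly3" where
  "subst3 F \<phi> \<equiv> eval3 (\<lambda>c. [:[:[:c:]:]:]) F \<phi>"

definition xyz :: "poly3 ^ 3" where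
  "xyz = vector [[:0, 1:], [:[:0, 1:]:], [:[:[:0, 1:]:]:]]"


section \<open>The projective plane and its Zariski topology\<close>

definition proportional :: "complex ^ 3 \<Rightarrow> complex ^ 3 \<Rightarrow> bool" where
  "proportional v w \<longleftrightarrow> v \<noteq> 0 \<and> w \<noteq> 0 \<and> (\<exists>c. w = c *s v)"

quotient_type proj_plane = "complex ^ 3" / partial: proportional
proof (rule part_equivpI)
  show "\<exists>v. proportional v v"
    by (rule exI[of _ "axis 1 1"]) (auto simp: proportional_def axis_eq_0_iff intro: exI[of _ 1])
  show "symp proportional"
  proof (rule sympI)
    fix v w assume "proportional v w"
    then obtain c where c: "v \<noteq> 0" "w \<noteq> 0" "w = c *s v" by (auto simp: proportional_def)
    then have "c \<noteq> 0" by auto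
    with c have "v = inverse c *s w" by (simp add: vector_smult_assoc)
    with c show "proportional w v" unfolding proportional_def by blast
  qed
  show "transp proportional"
    by (rule transpI) (auto simp: proportional_def vector_smult_assoc)
qed

text \<open>The point with homogeneous coordinates \<open>v\<close>; meaningful for \<open>v \<noteq> 0\<close> only.\<close>

abbreviation proj :: "complex ^ 3 \<Rightarrow> proj_plane" where
  "proj \<equiv> abs_proj_plane"

definition zero_locus :: "poly3 \<Rightarrow> proj_plane set" where
  "zero_locus F = {proj v | v. v \<noteq> 0 \<and> value_at F v = 0}"

definition zariski_closure :: "proj_plane set \<Rightarrow> proj_plane set" where
  "zariski_closure S = \<Inter> {zero_locus F | F. (\<exists>d. homogeneous d F) \<and> S \<subseteq> zero_locus F}"


section \<open>Irreducible plane curves\<close>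

text \<open>An irreducible plane curve is given by an irreducible form, which it determines up to a
  nonzero scalar. An irreducible polynomial is not a unit, so the degree is positive.\<close>

definition irreducible_plane_curve :: "poly3 \<Rightarrow> bool" where
  "irreducible_plane_curve F \<longleftrightarrow> irreducible F \<and> (\<exists>d. homogeneous d F)"

definition curve_degree :: "poly3 \<Rightarrow> nat" where
  "curve_degree F = (THE d. homogeneous d F)"


section \<open>Cremona equivalence\<close>

text \<open>A rational map of the plane to itself is given by three forms of the same degree without
  common factor; it is then undefined exactly at their common zeros.\<close>

definition rational_map :: "poly3 ^ 3 \<Rightarrow> bool" where
  "rational_map \<phi> \<longleftrightarrow> (\<exists>e. \<forall>i. homogeneous e (\<phi> $ i)) \<and> \<phi> \<noteq> 0 \<and>
     (\<forall>h. (\<forall>i. h dvd \<phi> $ i) \<longrightarrow> h dvd 1)"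

definition compose_map :: "poly3 ^ 3 \<Rightarrow> poly3 ^ 3 \<Rightarrow> poly3 ^ 3" where
  "compose_map \<psi> \<phi> = (\<chi> i. subst3 (\<psi> $ i) \<phi>)"

text \<open>Mutually inverse as rational maps: the composites equal \<open>(x : y : z)\<close> after removal of a
  common factor.\<close>

definition inverse_birational_maps :: "poly3 ^ 3 \<Rightarrow> poly3 ^ 3 \<Rightarrow> bool" where
  "inverse_birational_maps \<phi> \<psi> \<longleftrightarrow> rational_map \<phi> \<and> rational_map \<psi> \<and>
     (\<exists>h. h \<noteq> 0 \<and> compose_map \<psi> \<phi> = h *s xyz) \<and>
     (\<exists>h. h \<noteq> 0 \<and> compose_map \<phi> \<psi> = h *s xyz)"

definition map_value :: "poly3 ^ 3 \<Rightarrow> complex ^ 3 \<Rightarrow> complex ^ 3" where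
  "map_value \<phi> v = (\<chi> i. value_at (\<phi> $ i) v)"

definition map_image :: "poly3 ^ 3 \<Rightarrow> proj_plane set \<Rightarrow> proj_plane set" where
  "map_image \<phi> S = {proj (map_value \<phi> v) | v. v \<noteq> 0 \<and> proj v \<in> S \<and> map_value \<phi> v \<noteq> 0}"

definition contracts :: "poly3 ^ 3 \<Rightarrow> poly3 \<Rightarrow> bool" where
  "contracts \<phi> C \<longleftrightarrow> (\<exists>q. map_image \<phi> (zero_locus C) \<subseteq> {q})"

definition is_proper_image :: "poly3 ^ 3 \<Rightarrow> poly3 \<Rightarrow> poly3 \<Rightarrow> bool" where
  "is_proper_image \<phi> C B \<longleftrightarrow> zero_locus B = zariski_closure (map_image \<phi> (zero_locus C))"

definition cremona_equivalent :: "poly3 \<Rightarrow> poly3 \<Rightarrow> bool" where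
  "cremona_equivalent C B \<longleftrightarrow> irreducible_plane_curve C \<and> irreducible_plane_curve B \<and>
     (\<exists>\<phi> \<psi>. inverse_birational_maps \<phi> \<psi> \<and>
        \<not> contracts \<phi> C \<and> is_proper_image \<phi> C B \<and>
        \<not> contracts \<psi> B \<and> is_proper_image \<psi> B C)"

definition cremona_minimal_model :: "poly3 \<Rightarrow> poly3 \<Rightarrow> bool" where
  "cremona_minimal_model C B \<longleftrightarrow> cremona_equivalent C B \<and>
     (\<forall>B'. cremona_equivalent C B' \<longrightarrow> curve_degree B \<le> curve_degree B')"


section \<open>Infinitely near points and multiplicities\<close>

text \<open>Germs of curves are studied in affine coordinates \<open>(u, w)\<close> centred at the point under
  consideration. In \<^typ>\<open>poly2\<close> the outer variable is \<open>u\<close> and the inner one is \<open>w\<close>.\<close>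

definition var_u :: poly2 where "var_u = [:0, 1:]"

definition var_w :: poly2 where "var_w = [:[:0, 1:]:]"

definition const2 :: "complex \<Rightarrow> poly2" where "const2 c = [:[:c:]:]"

definition eval2 :: "poly2 \<Rightarrow> poly2 \<Rightarrow> poly2 \<Rightarrow> poly2" where
  "eval2 f a b =
     (\<Sum>i\<le>degree f. \<Sum>j\<le>degree (coeff f i). const2 (coeff (coeff f i) j) * a ^ i * b ^ j)"

definition mult_origin :: "poly2 \<Rightarrow> nat" where
  "mult_origin f = (LEAST m. \<exists>i j. i + j = m \<and> coeff (coeff f i) j \<noteq> 0)"

text \<open>Homogeneous coordinates of \<open>p\<close> whose first nonzero entry is \<open>1\<close>.\<close>

definition normal_coords :: "proj_plane \<Rightarrow> complex ^ 3" where
  "normal_coords p = (THE v. proj v = p \<and>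
     (v $ 1 = 1 \<or> (v $ 1 = 0 \<and> v $ 2 = 1) \<or> (v $ 1 = 0 \<and> v $ 2 = 0 \<and> v $ 3 = 1)))"

text \<open>Affine equation of the curve in the standard chart given by that entry, with \<open>p\<close> moved to
  the origin.\<close>

definition local_equation :: "poly3 \<Rightarrow> proj_plane \<Rightarrow> poly2" where
  "local_equation F p =
     (let v = normal_coords p in
      eval3 const2 F
       (if v $ 1 = 1 then vector [1, const2 (v $ 2) + var_u, const2 (v $ 3) + var_w]
        else if v $ 2 = 1 then vector [var_u, 1, const2 (v $ 3) + var_w]
        else vector [var_u, var_w, 1]))"

text \<open>The points of the exceptional curve of the blow-up of the origin are the directions at the
  origin: \<open>Slope t\<close> is the direction of the line \<open>w = t u\<close>, \<open>Vertical\<close> that of \<open>u = 0\<close>.\<close>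

datatype direction = Slope complex | Vertical

text \<open>The strict transform in coordinates centred at the given point of the exceptional curve.
  These are \<open>(u, w/u - t)\<close>, with exceptional curve \<open>u = 0\<close>, for \<open>Slope t\<close>, and \<open>(u/w, w)\<close>, with
  exceptional curve \<open>w = 0\<close>, for \<open>Vertical\<close>. The total transform is divisible by the power of the
  exceptional equation whose exponent is the multiplicity, so the divisions are exact.\<close>

fun strict_transform :: "direction \<Rightarrow> poly2 \<Rightarrow> poly2" where
  "strict_transform (Slope t) f =
     eval2 f var_u (var_u * (var_w + const2 t)) div var_u ^ mult_origin f"
| "strict_transform Vertical f =
     eval2 f (var_u * var_w) var_w div var_w ^ mult_origin f"

text \<open>A point of the plane or infinitely near to it is a point \<open>p\<close> of the plane together with the
  successive choices of a point on the exceptional curve of the blow-up of the preceding point.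
  The empty list gives the proper point \<open>p\<close> itself.\<close>

type_synonym near_point = "proj_plane \<times> direction list"

definition germ_at :: "poly3 \<Rightarrow> near_point \<Rightarrow> poly2" where
  "germ_at F q = fold strict_transform (snd q) (local_equation F (fst q))"

definition multiplicity_at :: "poly3 \<Rightarrow> near_point \<Rightarrow> nat" where
  "multiplicity_at F q = mult_origin (germ_at F q)"

definition curve_points :: "poly3 \<Rightarrow> near_point set" where
  "curve_points F = {q. multiplicity_at F q > 0}"

text \<open>Every point counts as infinitely near (of order zero) to itself.\<close>

definition infinitely_near :: "near_point \<Rightarrow> near_point \<Rightarrow> bool" where
  "infinitely_near q p \<longleftrightarrow> fst q = fst p \<and> (\<exists>ds. snd q = snd p @ ds)"

end

theory Submission
  imports Defs "HOL-Computational_Algebra.Field_as_Ring"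
begin

text \<open>Suppose that \<open>B\<close> has degree \<open>d \<ge> 2\<close>, that some three points of \<open>B\<close> have multiplicities with
  sum greater than \<open>d\<close>, and that for every point \<open>p\<close> of maximal multiplicity \<open>m\<^sub>0\<close> some point of
  multiplicity at least \<open>(d - m\<^sub>0) / 2\<close> is not infinitely near to \<open>p\<close>. The degree of \<open>B\<close> can then be
  lowered by one quadratic transformation, so \<open>B\<close> is not minimal. The transform of \<open>B\<close> has degree
  \<open>2 d - m\<^sub>1 - m\<^sub>2 - m\<^sub>3\<close> when its three base points have multiplicities \<open>m\<^sub>1, m\<^sub>2, m\<^sub>3\<close> on \<open>B\<close>. Thus what has to be
  found are three points with multiplicities of sum greater than \<open>d\<close> that can be the base points of
  a quadratic map: three proper points, or two proper points and one in the first neighbourhood of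
  one of them, not on a line.

  The choice of points is the combinatorial lemma \<open>base_points_of_reduction\<close>. It only uses that
  multiplicities do not increase along infinitely near points. The second assumption above provides
  a proper second base point \<open>Q\<close> in the case that the large multiplicities are all infinitely
  near to \<open>p\<close>: a point of the first neighbourhood of \<open>p\<close> with multiplicity greater than \<open>(d - m\<^sub>0) / 2\<close>,
  together with \<open>p\<close> and \<open>Q\<close>, is admissible. Collinear points do not occur, since the line through them
  would meet \<open>B\<close> in more than \<open>d\<close> points (\<open>line_bound\<close>).

  After a linear change of coordinates the quadratic maps are \<open>(y z : x z : x y)\<close> and
  \<open>(x z : y z : y\<^sup>2)\<close>. Multiplicities enter only through divisibility: if \<open>v\<close> is a point of multiplicity
  \<open>m\<close>, then \<open>x\<^sup>m\<close> divides \<open>F(\<rho> v + x \<eta>)\<close>, and there is a similar statement with \<open>m + m'\<close> for a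
  point of multiplicity \<open>m'\<close> in the first neighbourhood of \<open>v\<close> (\<open>proper_point_vanishing\<close>, \<open>near_point_vanishing\<close>). Both follow by rewriting
  the local equation at \<open>v\<close> as a dehomogenization of \<open>F\<close> in adapted linear coordinates. So the
  pullback of \<open>B\<close> contains exceptional lines of total degree greater than \<open>d\<close>, and what remains
  has degree less than \<open>d\<close> (\<open>quadratic_reduction\<close>).

  That a factor of what remains is Cremona equivalent to \<open>C\<close> is shown algebraically. For irreducible
  curves the Nullstellensatz translates "\<open>B\<close> is the proper image of \<open>C\<close> under \<open>\<phi>\<close>" into: a form \<open>G\<close> is
  divisible by \<open>B\<close> iff \<open>G \<circ> \<phi>\<close> is divisible by \<open>C\<close> (\<open>is_proper_image_iff\<close>). In this shape proper images
  compose without any discussion of base points, and common factors are cancelled at the end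
  (\<open>cremona_equivalentI\<close>).\<close>

text \<open>The symbol is kept for components of vectors.\<close>

no_notation fps_nth (infixl "$" 75)

section \<open>Evaluation homomorphisms\<close>

definition unital_hom :: "('a::comm_ring_1 \<Rightarrow> 'b::comm_ring_1) \<Rightarrow> bool" where
  "unital_hom h \<longleftrightarrow> h 1 = 1 \<and> (\<forall>a b. h (a + b) = h a + h b) \<and> (\<forall>a b. h (a * b) = h a * h b)"

lemma unital_homI:
  assumes "h 1 = 1" "\<And>a b. h (a + b) = h a + h b" "\<And>a b. h (a * b) = h a * h b"
  shows "unital_hom h"
  using assms by (simp add: unital_hom_def)

lemma unital_hom_0:
  assumes "unital_hom h" shows "h 0 = 0"
proof -
  have "h (0 + 0) = h 0 + h 0" using assms by (simp only: unital_hom_def)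
  then show ?thesis by simp
qed

lemma unital_hom_minus:
  assumes "unital_hom h" shows "h (- a) = - h a"
proof -
  have "h (a + - a) = h a + h (- a)" using assms by (simp only: unital_hom_def)
  then have "0 = h a + h (- a)" by (simp add: unital_hom_0[OF assms])
  then show ?thesis by (metis add.inverse_unique)
qed

lemma unital_hom_diff:
  assumes "unital_hom h" shows "h (a - b) = h a - h b"
  using assms unital_hom_minus[OF assms, of b] unfolding unital_hom_def
  by (metis diff_conv_add_uminus)

lemma unital_hom_power:
  assumes "unital_hom h" shows "h (a ^ n) = h a ^ n"
  using assms by (induction n) (simp_all add: unital_hom_def)

lemma unital_hom_sum:
  assumes "unital_hom h" shows "h (sum f A) = (\<Sum>x\<in>A. h (f x))"
  using assms
  by (induction A rule: infinite_finite_induct) (simp_all add: unital_hom_0, simp add: unital_hom_def)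

lemmas unital_hom_simps = unital_hom_0 unital_hom_minus unital_hom_diff unital_hom_power unital_hom_sum

lemma unital_hom_1: "unital_hom h \<Longrightarrow> h 1 = 1"
  and unital_hom_add: "unital_hom h \<Longrightarrow> h (a + b) = h a + h b"
  and unital_hom_mult: "unital_hom h \<Longrightarrow> h (a * b) = h a * h b"
  by (simp_all add: unital_hom_def)

lemma unital_hom_comp: "unital_hom f \<Longrightarrow> unital_hom g \<Longrightarrow> unital_hom (\<lambda>x. f (g x))"
  by (simp add: unital_hom_def)

lemma unital_hom_dvd: "unital_hom h \<Longrightarrow> a dvd b \<Longrightarrow> h a dvd h b"
  by (auto simp: unital_hom_def dvd_def)

lemma unital_hom_ident: "unital_hom (\<lambda>c. c)"
  by (simp add: unital_hom_def)

lemma unital_hom_const_poly: "unital_hom (\<lambda>c. [:c:])"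
  by (simp add: unital_hom_def)

text \<open>The nested sum defining \<^const>\<open>eval3\<close> is
  \<^term>\<open>hom_poly\<close> used once for each variable; the homomorphism property then
  needs to be shown for one variable only.\<close>

definition hom_poly :: "('a::comm_ring_1 \<Rightarrow> 'b::comm_ring_1) \<Rightarrow> 'b \<Rightarrow> 'a poly \<Rightarrow> 'b" where
  "hom_poly h a p = (\<Sum>i\<le>degree p. h (coeff p i) * a ^ i)"

lemma hom_poly_upper:
  assumes "h 0 = 0" "degree p \<le> N"
  shows "hom_poly h a p = (\<Sum>i\<le>N. h (coeff p i) * a ^ i)"
  unfolding hom_poly_def
  by (rule sum.mono_neutral_left) (use assms in \<open>auto simp: coeff_eq_0\<close>)

lemma hom_poly_pCons:
  assumes "h 0 = 0"
  shows "hom_poly h a (pCons c p) = h c + a * hom_poly h a p"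
proof -
  have "hom_poly h a (pCons c p) = (\<Sum>i\<le>Suc (degree p). h (coeff (pCons c p) i) * a ^ i)"
    by (rule hom_poly_upper) (auto simp: assms degree_pCons_le)
  also have "\<dots> = h c + (\<Sum>i\<le>degree p. h (coeff p i) * a ^ Suc i)"
    by (subst sum.atMost_Suc_shift) simp
  also have "(\<Sum>i\<le>degree p. h (coeff p i) * a ^ Suc i) = a * hom_poly h a p"
    by (simp add: hom_poly_def sum_distrib_left algebra_simps)
  finally show ?thesis .
qed

lemma hom_poly_0 [simp]: "h 0 = 0 \<Longrightarrow> hom_poly h a 0 = 0"
  by (simp add: hom_poly_def)

lemma unital_hom_hom_poly:
  assumes h: "unital_hom h"
  shows "unital_hom (hom_poly h a)"
proof (rule unital_homI)
  note h0 = unital_hom_0[OF h]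
  have add: "hom_poly h a (p + q) = hom_poly h a p + hom_poly h a q" for p q
    by (induction p q rule: poly_induct2)
       (simp_all add: h0 hom_poly_pCons unital_hom_add[OF h] algebra_simps)
  show "hom_poly h a (p + q) = hom_poly h a p + hom_poly h a q" for p q by (rule add)
  have smult: "hom_poly h a (smult c q) = h c * hom_poly h a q" for c q
    by (induction q) (simp_all add: h0 hom_poly_pCons unital_hom_mult[OF h] algebra_simps)
  show "hom_poly h a (p * q) = hom_poly h a p * hom_poly h a q" for p q
    by (induction p) (simp_all add: h0 hom_poly_pCons add smult algebra_simps)
  show "hom_poly h a 1 = 1"
    by (simp add: one_pCons hom_poly_pCons h0 unital_hom_1[OF h])
qed

lemma hom_poly_const: "unital_hom h \<Longrightarrow> hom_poly h a [:c:] = h c"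
  by (simp add: hom_poly_pCons unital_hom_0)

lemma hom_poly_X: "unital_hom h \<Longrightarrow> hom_poly h a [:0, 1:] = a"
  by (simp add: hom_poly_pCons unital_hom_0 unital_hom_1)

lemma unital_hom_poly_eqI:
  assumes f: "unital_hom f" and g: "unital_hom g"
    and c: "\<And>c. f [:c:] = g [:c:]" and X: "f [:0, 1:] = g [:0, 1:]"
  shows "f p = g p"
proof (induction p)
  case 0
  show ?case by (simp add: unital_hom_0 f g)
next
  case (pCons a p)
  have "pCons a p = [:a:] + [:0, 1:] * p" by simp
  then show ?case
    using pCons.IH by (simp only: unital_hom_add[OF f] unital_hom_add[OF g]
      unital_hom_mult[OF f] unital_hom_mult[OF g] c X)
qed

lemma eval3_conv_hom_poly:
  "eval3 \<iota> F a = hom_poly (hom_poly (hom_poly \<iota> (a $ 3)) (a $ 2)) (a $ 1) F"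
  by (simp add: eval3_def hom_poly_def coeff3_def sum_distrib_left sum_distrib_right
      mult.assoc mult.commute mult.left_commute)

lemma eval2_conv_hom_poly: "eval2 f a b = hom_poly (hom_poly const2 b) a f"
  by (simp add: eval2_def hom_poly_def sum_distrib_left sum_distrib_right
      mult.assoc mult.commute mult.left_commute)

definition const3 :: "complex \<Rightarrow> poly3" where "const3 c = [:[:[:c:]:]:]"

lemma unital_hom_const2: "unital_hom const2"
  by (simp add: unital_hom_def const2_def one_pCons)

lemma unital_hom_const3: "unital_hom const3"
  by (simp add: unital_hom_def const3_def one_pCons)

lemma xyz_nth: "xyz $ 1 = [:0, 1:]" "xyz $ 2 = [:[:0, 1:]:]" "xyz $ 3 = [:[:[:0, 1:]:]:]"
  by (simp_all add: xyz_def)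

lemma unital_hom_eval3:
  assumes "unital_hom \<iota>" shows "unital_hom (\<lambda>F. eval3 \<iota> F a)"
  unfolding eval3_conv_hom_poly by (intro unital_hom_hom_poly assms)

lemma eval3_const3: "unital_hom \<iota> \<Longrightarrow> eval3 \<iota> (const3 c) a = \<iota> c"
  by (simp add: eval3_conv_hom_poly const3_def hom_poly_const unital_hom_hom_poly)

lemma eval3_xyz:
  assumes "unital_hom \<iota>" shows "eval3 \<iota> (xyz $ i) a = a $ i"
proof -
  have "i = 1 \<or> i = 2 \<or> i = 3" using exhaust_3 by blast
  then show ?thesis using assms
    by (auto simp: eval3_conv_hom_poly xyz_nth hom_poly_const hom_poly_X unital_hom_hom_poly)
qed

text \<open>Constants and coordinates generate the polynomial ring. All identities between
  substitutions below are obtained from this uniqueness, never by comparing sums.\<close>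

lemma unital_hom_poly3_eqI:
  fixes f g :: "poly3 \<Rightarrow> 'r::comm_ring_1"
  assumes f: "unital_hom f" and g: "unital_hom g"
    and c: "\<And>c. f (const3 c) = g (const3 c)" and X: "\<And>i. f (xyz $ i) = g (xyz $ i)"
  shows "f = g"
proof
  fix F
  have f1: "unital_hom (\<lambda>q. f [:q:])" and g1: "unital_hom (\<lambda>q. g [:q:])"
    using unital_hom_comp[OF f unital_hom_const_poly] unital_hom_comp[OF g unital_hom_const_poly]
    by simp_all
  have f2: "unital_hom (\<lambda>q. f [:[:q:]:])" and g2: "unital_hom (\<lambda>q. g [:[:q:]:])"
    using unital_hom_comp[OF f1 unital_hom_const_poly] unital_hom_comp[OF g1 unital_hom_const_poly]
    by simp_all
  have 1: "f [:[:q:]:] = g [:[:q:]:]" for q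
    by (rule unital_hom_poly_eqI[OF f2 g2])
       (use c X[of 3] in \<open>simp_all add: const3_def xyz_nth\<close>)
  have 2: "f [:q:] = g [:q:]" for q
    by (rule unital_hom_poly_eqI[OF f1 g1]) (use 1 X[of 2] in \<open>simp_all add: xyz_nth\<close>)
  show "f F = g F"
    by (rule unital_hom_poly_eqI[OF f g]) (use 2 X[of 1] in \<open>simp_all add: xyz_nth\<close>)
qed

text \<open>Both sides are homomorphisms in \<open>F\<close> with the same effect on constants
  and coordinates.\<close>

lemma unital_hom_eval3_comp:
  assumes "unital_hom h" "unital_hom \<iota>"
  shows "h (eval3 \<iota> F a) = eval3 (\<lambda>c. h (\<iota> c)) F (\<chi> i. h (a $ i))"
proof -
  have "(\<lambda>F. h (eval3 \<iota> F a)) = (\<lambda>F. eval3 (\<lambda>c. h (\<iota> c)) F (\<chi> i. h (a $ i)))"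
    by (rule unital_hom_poly3_eqI)
       (simp_all add: assms unital_hom_comp unital_hom_eval3 eval3_const3 eval3_xyz
          unital_hom_comp[OF assms(1) unital_hom_eval3])
  then show ?thesis by (rule fun_cong)
qed

lemma const3_eq: "(\<lambda>c. [:[:[:c:]:]:]) = const3"
  by (simp add: const3_def fun_eq_iff)

lemma eval3_subst3:
  assumes "unital_hom \<iota>"
  shows "eval3 \<iota> (eval3 const3 F b) a = eval3 \<iota> F (\<chi> i. eval3 \<iota> (b $ i) a)"
  using unital_hom_eval3_comp[OF unital_hom_eval3[OF assms] unital_hom_const3, of F b a]
  by (simp add: eval3_const3 assms)

lemma eval3_const3_xyz: "eval3 const3 F xyz = F"
proof -
  have "(\<lambda>F. eval3 const3 F xyz) = (\<lambda>F. F)"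
    by (rule unital_hom_poly3_eqI)
       (simp_all add: unital_hom_eval3 unital_hom_const3 unital_hom_ident eval3_const3 eval3_xyz)
  then show ?thesis by (rule fun_cong)
qed

section \<open>Forms\<close>

lemma homogeneous_eval3_scale:
  assumes "homogeneous d F" "unital_hom \<iota>"
  shows "eval3 \<iota> F (s *s a) = s ^ d * eval3 \<iota> F a" (is "?l = ?r")
proof -
  have eq: "\<iota> (coeff3 F i j k) * (s *s a) $ 1 ^ i * (s *s a) $ 2 ^ j * (s *s a) $ 3 ^ k =
      s ^ d * (\<iota> (coeff3 F i j k) * a $ 1 ^ i * a $ 2 ^ j * a $ 3 ^ k)" for i j k
  proof (cases "coeff3 F i j k = 0")
    case False
    then have "d = i + j + k" using assms by (auto simp: homogeneous_def)
    then show ?thesis by (simp add: power_mult_distrib power_add mult_ac)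
  qed (simp add: unital_hom_0[OF assms(2)])
  show ?thesis unfolding eval3_def sum_distrib_left eq ..
qed

definition mono3 :: "complex \<Rightarrow> nat \<Rightarrow> nat \<Rightarrow> nat \<Rightarrow> poly3" where
  "mono3 c i j k = monom (monom (monom c k) j) i"

lemma mono3_eq: "const3 c * xyz $ 1 ^ i * xyz $ 2 ^ j * xyz $ 3 ^ k = mono3 c i j k"
proof -
  have 1: "const3 c = monom (monom (monom c 0) 0) 0" by (simp add: const3_def monom_0)
  have 2: "xyz $ 1 = monom 1 1" "xyz $ 2 = monom (monom 1 1) 0" "xyz $ 3 = monom (monom (monom 1 1) 0) 0"
    by (simp_all add: xyz_nth monom_altdef)
  show ?thesis unfolding 1 2 by (simp add: monom_power mult_monom mono3_def)
qed

lemma coeff3_mono3: "coeff3 (mono3 c i j k) i' j' k' = (if i = i' \<and> j = j' \<and> k = k' then c else 0)"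
  by (simp add: coeff3_def mono3_def)

lemma coeff3_sum: "coeff3 (sum f A) i j k = (\<Sum>x\<in>A. coeff3 (f x) i j k)"
  by (simp add: coeff3_def coeff_sum)

lemma poly3_eqI: "(\<And>i j k. coeff3 F i j k = coeff3 G i j k) \<Longrightarrow> F = G"
  by (simp add: coeff3_def poly_eq_iff)

lemma coeff3_0 [simp]: "coeff3 0 i j k = 0"
  by (simp add: coeff3_def)

text \<open>The substitution \<open>(x, y, z) \<mapsto> (t x, t y, t z)\<close>, with
  \<open>t\<close> the outermost variable: the coefficient of \<open>t\<^sup>e\<close> is the
  homogeneous component of degree \<open>e\<close>. As a ring homomorphism it turns statements
  about forms into statements about monomials in \<open>t\<close>.\<close>

definition grade :: "poly3 \<Rightarrow> poly3 poly" where
  "grade F = eval3 (\<lambda>c. [:const3 c:]) F (\<chi> i. monom (xyz $ i) 1)"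

lemma unital_hom_grade: "unital_hom grade"
  unfolding grade_def
  by (intro unital_hom_eval3 unital_hom_comp[OF unital_hom_const_poly unital_hom_const3])

lemma grade_expand:
  "grade F = (\<Sum>i\<le>degree F. \<Sum>j\<le>degree (coeff F i). \<Sum>k\<le>degree (coeff (coeff F i) j).
     monom (mono3 (coeff3 F i j k) i j k) (i + j + k))"
proof -
  have "[:const3 c:] * monom (xyz $ 1) 1 ^ i * monom (xyz $ 2) 1 ^ j * monom (xyz $ 3) 1 ^ k =
      monom (mono3 c i j k) (i + j + k)" for c i j k
    unfolding monom_0[symmetric] monom_power mult_monom mono3_eq by simp
  then show ?thesis by (simp add: grade_def eval3_def)
qed

lemma poly3_expand:
  "F = (\<Sum>i\<le>degree F. \<Sum>j\<le>degree (coeff F i). \<Sum>k\<le>degree (coeff (coeff F i) j).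
     mono3 (coeff3 F i j k) i j k)"
  using eval3_const3_xyz[of F] by (simp add: eval3_def mono3_eq)

lemma coeff3_coeff_grade:
  "coeff3 (coeff (grade F) e) i j k = (if i + j + k = e then coeff3 F i j k else 0)"
proof -
  have "coeff3 (coeff (grade F) e) i j k =
    (\<Sum>i'\<le>degree F. \<Sum>j'\<le>degree (coeff F i'). \<Sum>k'\<le>degree (coeff (coeff F i') j').
      if i' + j' + k' = e then coeff3 (mono3 (coeff3 F i' j' k') i' j' k') i j k else 0)"
    unfolding grade_expand
    by (auto simp: coeff_sum coeff3_sum intro!: sum.cong)
  also have "\<dots> = (\<Sum>i'\<le>degree F. \<Sum>j'\<le>degree (coeff F i'). \<Sum>k'\<le>degree (coeff (coeff F i') j').
      if i + j + k = e then coeff3 (mono3 (coeff3 F i' j' k') i' j' k') i j k else 0)"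
    by (intro sum.cong) (auto simp: coeff3_mono3)
  also have "\<dots> = (if i + j + k = e then coeff3 F i j k else 0)"
    by (subst (6) poly3_expand) (simp add: coeff3_sum)
  finally show ?thesis .
qed

lemma homogeneous_iff_grade: "homogeneous d F \<longleftrightarrow> grade F = monom F d"
proof
  assume "homogeneous d F"
  then have "coeff3 (coeff (grade F) e) i j k = coeff3 (coeff (monom F d) e) i j k" for e i j k
    by (auto simp: coeff3_coeff_grade homogeneous_def)
  then have "coeff (grade F) e = coeff (monom F d) e" for e by (rule poly3_eqI)
  then show "grade F = monom F d" by (simp add: poly_eq_iff)
next
  assume g: "grade F = monom F d"
  show "homogeneous d F" unfolding homogeneous_def
  proof (intro allI impI)
    fix i j k assume nz: "coeff3 F i j k \<noteq> 0"
    have "coeff3 (coeff (grade F) d) i j k = coeff3 F i j k" by (simp add: g)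
    then show "i + j + k = d" using nz by (auto simp: coeff3_coeff_grade split: if_splits)
  qed
qed

lemma grade_monom_homogeneous:
  assumes "grade F = monom G e" shows "homogeneous e F"
proof -
  have "coeff3 F i j k = 0" if "i + j + k \<noteq> e" for i j k
  proof -
    have "coeff3 (coeff (grade F) (i + j + k)) i j k = coeff3 (coeff (monom G e) (i + j + k)) i j k"
      by (simp add: assms)
    then show ?thesis using that by (simp add: coeff3_coeff_grade)
  qed
  then show ?thesis by (auto simp: homogeneous_def)
qed

lemma homogeneous_mult: "homogeneous d F \<Longrightarrow> homogeneous e G \<Longrightarrow> homogeneous (d + e) (F * G)"
  by (simp add: homogeneous_iff_grade unital_hom_mult[OF unital_hom_grade] mult_monom)

lemma homogeneous_add: "homogeneous d F \<Longrightarrow> homogeneous d G \<Longrightarrow> homogeneous d (F + G)"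
  by (simp add: homogeneous_iff_grade unital_hom_add[OF unital_hom_grade] add_monom)

lemma homogeneous_0 [simp]: "homogeneous d 0"
  by (simp add: homogeneous_def)

lemma homogeneous_sum: "(\<And>x. x \<in> A \<Longrightarrow> homogeneous d (f x)) \<Longrightarrow> homogeneous d (sum f A)"
  by (induction A rule: infinite_finite_induct) (simp_all add: homogeneous_add)

lemma homogeneous_const3 [simp]: "homogeneous 0 (const3 c)"
  by (simp add: homogeneous_iff_grade grade_def eval3_const3 monom_0
     unital_hom_comp[OF unital_hom_const_poly unital_hom_const3])

lemma homogeneous_xyz [simp]: "homogeneous 1 (xyz $ i)"
  by (simp add: homogeneous_iff_grade grade_def eval3_xyz
     unital_hom_comp[OF unital_hom_const_poly unital_hom_const3])

lemma homogeneous_power: "homogeneous d F \<Longrightarrow> homogeneous (n * d) (F ^ n)"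
proof (induction n)
  case 0
  show ?case using homogeneous_const3[of 1] by (simp add: const3_def one_pCons)
next
  case (Suc n)
  then show ?case using homogeneous_mult[of d F "n * d" "F ^ n"] by simp
qed

lemma homogeneous_subst3:
  assumes F: "homogeneous d F" and a: "\<And>i. homogeneous e (a $ i)"
  shows "homogeneous (d * e) (eval3 const3 F a)"
  unfolding eval3_def
proof (intro homogeneous_sum)
  fix i j k
  show "homogeneous (d * e) (const3 (coeff3 F i j k) * a $ 1 ^ i * a $ 2 ^ j * a $ 3 ^ k)"
  proof (cases "coeff3 F i j k = 0")
    case False
    then have "d = i + j + k" using F by (auto simp: homogeneous_def)
    then have "d * e = 0 + i * e + j * e + k * e" by (simp add: algebra_simps)
    moreover have "homogeneous (0 + i * e + j * e + k * e)
        (const3 (coeff3 F i j k) * a $ 1 ^ i * a $ 2 ^ j * a $ 3 ^ k)"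
      by (intro homogeneous_mult homogeneous_power homogeneous_const3 a)
    ultimately show ?thesis by simp
  qed (simp add: const3_def)
qed

lemma homogeneous_unique: "homogeneous d F \<Longrightarrow> homogeneous e F \<Longrightarrow> F \<noteq> 0 \<Longrightarrow> d = e"
  by (metis homogeneous_iff_grade monom_eq_iff')

lemma curve_degree_eq: "homogeneous d F \<Longrightarrow> F \<noteq> 0 \<Longrightarrow> curve_degree F = d"
  unfolding curve_degree_def by (intro the_equality) (auto dest: homogeneous_unique)

lemma homogeneous_0_const: 
  assumes "homogeneous 0 F" shows "F = const3 (coeff3 F 0 0 0)"
proof (rule poly3_eqI)
  fix i j k
  show "coeff3 F i j k = coeff3 (const3 (coeff3 F 0 0 0)) i j k"
    using assms mono3_eq[of "coeff3 F 0 0 0" 0 0 0]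
    by (auto simp: coeff3_mono3 homogeneous_def)
qed

text \<open>Split off the largest power of the variable from each factor; the two cofactors have
  nonzero constant terms and degrees with sum zero.\<close>

lemma factor_of_monom:
  fixes p q :: "'a::idom poly"
  assumes "p * q = monom c n" "c \<noteq> 0"
  shows "\<exists>b m. p = monom b m"
proof -
  have nz: "p \<noteq> 0" "q \<noteq> 0" using assms by auto
  have split: "\<exists>m r. f = monom 1 m * r \<and> coeff r 0 \<noteq> 0" if "f \<noteq> 0" for f :: "'a poly"
    using order_decomp[OF that, of 0] 
    by (auto simp: monom_altdef dvd_iff_poly_eq_0 poly_0_coeff_0 intro!: exI[of _ "order 0 f"])
  obtain m r where p: "p = monom 1 m * r" "coeff r 0 \<noteq> 0" using split nz by blast
  obtain m' r' where q: "q = monom 1 m' * r'" "coeff r' 0 \<noteq> 0" using split nz by blast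
  have rr: "monom 1 (m + m') * (r * r') = monom c n"
  proof -
    have e: "monom 1 (m + m') = monom 1 m * monom (1::'a) m'" by (simp add: mult_monom)
    show ?thesis using assms(1) unfolding p(1) q(1) e by (simp only: mult_ac)
  qed
  have "coeff (monom 1 (m + m') * (r * r')) (m + m') = coeff r 0 * coeff r' 0"
    by (simp add: coeff_monom_mult coeff_mult_0)
  then have "n = m + m'" using p q rr by (auto split: if_splits)
  moreover have "degree (monom 1 (m + m') * (r * r')) = m + m' + degree r + degree r'"
  proof -
    have "r \<noteq> 0" "r' \<noteq> 0" using p(2) q(2) by auto
    then show ?thesis by (simp add: degree_mult_eq degree_monom_eq)
  qed
  ultimately have "degree r = 0" using rr assms(2) by (simp add: degree_monom_eq)
  then obtain b where "r = [:b:]" by (elim degree_eq_zeroE)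
  then have "p = monom b m" using p by (simp add: mult.commute smult_monom)
  then show ?thesis by blast
qed

text \<open>Over a domain a factor of a monomial in \<open>t\<close> is again one, so grading
  makes factors of forms into forms.\<close>

lemma homogeneous_factor:
  assumes "homogeneous d (P * Q)" "P * Q \<noteq> 0"
  shows "\<exists>e. homogeneous e P"
proof -
  have "grade P * grade Q = monom (P * Q) d"
    using assms by (simp add: homogeneous_iff_grade unital_hom_mult[OF unital_hom_grade])
  from factor_of_monom[OF this assms(2)] show ?thesis
    by (blast intro: grade_monom_homogeneous)
qed

lemma homogeneous_dvd:
  assumes "homogeneous d F" "F \<noteq> 0" "P dvd F"
  shows "\<exists>e\<le>d. homogeneous e P"
proof -
  from assms(3) obtain Q where Q: "F = P * Q" by (elim dvdE)
  obtain e where e: "homogeneous e P" using homogeneous_factor assms Q by blast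
  obtain e' where e': "homogeneous e' Q"
    using homogeneous_factor[of d Q P] assms Q by (auto simp: mult.commute)
  have "d = e + e'" using homogeneous_unique[OF assms(1)] homogeneous_mult[OF e e'] Q assms(2) by auto
  then show ?thesis using e le_add1 by blast
qed

lemma homogeneous_0_unit:
  assumes "homogeneous 0 F" "F \<noteq> 0" shows "is_unit F"
proof -
  obtain c where F: "F = const3 c" using homogeneous_0_const[OF assms(1)] by blast
  then have "c \<noteq> 0" using assms(2) by (auto simp: const3_def)
  then have "const3 c * const3 (inverse c) = 1"
    by (simp add: const3_def one_pCons)
  then show ?thesis unfolding F by (metis dvdI)
qed

section \<open>A Nullstellensatz for one irreducible polynomial\<close>

text \<open>A set of ring homomorphisms to \<open>\<complex>\<close>, thought of as points, with
  enough points to recognize zero and to recognize the multiples of an irreducible element by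
  their values. The third property is the Nullstellensatz for hypersurfaces; phrased like this
  it can be carried from a ring to the polynomials over it.\<close>

definition vanishing_test :: "('a::comm_ring_1 \<Rightarrow> complex) set \<Rightarrow> bool" where
  "vanishing_test E \<longleftrightarrow> (\<forall>e\<in>E. unital_hom e) \<and> (\<forall>r. r \<noteq> 0 \<longrightarrow> (\<exists>e\<in>E. e r \<noteq> 0)) \<and>
     (\<forall>f g. irreducible f \<longrightarrow> (\<forall>e\<in>E. e f = 0 \<longrightarrow> e g = 0) \<longrightarrow> f dvd g)"

lemma hom_poly_conv_poly:
  assumes "unital_hom h" shows "hom_poly h a p = poly (map_poly h p) a"
  by (induction p) (simp_all add: hom_poly_pCons map_poly_pCons unital_hom_0[OF assms])

text \<open>Take an element of least degree in the ideal of \<open>F\<close> and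
  \<open>G\<close>. By pseudo-division it divides a constant multiple of each of them, and as
  \<open>F\<close> is prime and does not divide \<open>G\<close>, it must be constant.\<close>

lemma prime_elem_bezout_const:
  fixes F G :: "'a::{factorial_ring_gcd, semiring_gcd_mult_normalize} poly"
  assumes F: "prime_elem F" "degree F > 0" and ndvd: "\<not> F dvd G"
  shows "\<exists>a b r. r \<noteq> 0 \<and> a * F + b * G = [:r:]"
proof -
  define S where "S = {p. p \<noteq> 0 \<and> (\<exists>a b. p = a * F + b * G)}"
  have "F \<noteq> 0" using F by auto
  then have "F \<in> S" unfolding S_def by (auto intro: exI[of _ 1] exI[of _ 0])
  then obtain p where p: "p \<in> S" and min: "\<And>s. s \<in> S \<Longrightarrow> degree p \<le> degree s"
    using ex_has_least_nat[of "\<lambda>p. p \<in> S" F degree] by blast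
  obtain a b where ab: "p = a * F + b * G" and p0: "p \<noteq> 0" using p by (auto simp: S_def)
  have div: "\<exists>c. c \<noteq> 0 \<and> p dvd smult c P" if P: "P = a' * F + b' * G" for P a' b'
  proof -
    obtain q s where qs: "pseudo_divmod P p = (q, s)" by force
    define c where "c = coeff p (degree p) ^ (Suc (degree P) - degree p)"
    have c: "c \<noteq> 0" using p0 by (simp add: c_def)
    have eq: "smult c P = p * q + s" and s: "s = 0 \<or> degree s < degree p"
      using pseudo_divmod[OF p0 qs] by (auto simp: c_def)
    have "s = (smult c a' - q * a) * F + (smult c b' - q * b) * G"
      using eq unfolding P ab by (simp add: algebra_simps smult_add_right)
    then have "s \<in> S" if "s \<noteq> 0" using that unfolding S_def by blast
    then have "s = 0" using s min[of s] by fastforce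
    then show ?thesis using c eq by auto
  qed
  have "degree p = 0"
  proof -
    obtain c where c: "c \<noteq> 0" "p dvd smult c F" using div[of F 1 0] by auto
    obtain c' where c': "c' \<noteq> 0" "p dvd smult c' G" using div[of G 0 1] by auto
    obtain q where q: "smult c F = p * q" using c by (elim dvdE)
    have "F dvd p * q" unfolding q[symmetric] by (simp add: dvd_smult)
    then consider "F dvd p" | "F dvd q" using F(1) prime_elem_dvd_multD by blast
    then show ?thesis
    proof cases
      case 1
      then have "F dvd [:c':] * G" using c' dvd_trans by auto
      then have "F dvd [:c':]" using F(1) ndvd prime_elem_dvd_multD by blast
      then have "degree F \<le> 0" using c'(1) by (metis dvd_imp_degree_le degree_pCons_0 pCons_eq_0_iff)
      then show ?thesis using F(2) by simp
    next
      case 2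
      then obtain t where "q = F * t" by (elim dvdE)
      then have "F * [:c:] = F * (p * t)" using q by (simp add: mult_ac)
      then have "[:c:] = p * t" using \<open>F \<noteq> 0\<close> mult_left_cancel by blast
      then have "degree p \<le> degree [:c:]" using c(1) by (intro dvd_imp_degree_le) auto
      then show ?thesis by simp
    qed
  qed
  then obtain r where "p = [:r:]" by (elim degree_eq_zeroE)
  then show ?thesis using ab p0 by (intro exI[of _ a] exI[of _ b] exI[of _ r]) auto
qed

text \<open>If \<open>F\<close> has positive degree and does not divide \<open>G\<close>, a
  combination of the two is a nonzero constant \<open>r\<close>. At a point where
  \<open>r\<close> and the leading coefficient of \<open>F\<close> do not vanish,
  \<open>F\<close> becomes a nonconstant complex polynomial; at any root of it \<open>G\<close>
  cannot vanish, since \<open>r\<close> does not. If \<open>F\<close> is constant, the property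
  of the coefficient ring is applied to each coefficient of \<open>G\<close>.\<close>

lemma vanishing_test_poly:
  fixes E :: "('a::{factorial_ring_gcd, semiring_gcd_mult_normalize} \<Rightarrow> complex) set"
  assumes E: "vanishing_test E"
  shows "vanishing_test {hom_poly e x | e x. e \<in> E}"
proof -
  have hom: "unital_hom e" if "e \<in> E" for e using E that by (simp add: vanishing_test_def)
  have nz: "\<exists>e\<in>E. e r \<noteq> 0" if "r \<noteq> 0" for r using E that by (simp add: vanishing_test_def)
  have null: "f dvd g" if "irreducible f" "\<And>e. e \<in> E \<Longrightarrow> e f = 0 \<Longrightarrow> e g = 0" for f g
    using E that by (simp add: vanishing_test_def)
  have coeff: "coeff (map_poly e p) i = e (coeff p i)" if "e \<in> E" for e p i
    using unital_hom_0[OF hom[OF that]] by (simp add: coeff_map_poly)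
  have nz': "\<exists>e\<in>E. \<exists>x. hom_poly e x p \<noteq> 0" if "p \<noteq> 0" for p
  proof -
    obtain e where e: "e \<in> E" "e (lead_coeff p) \<noteq> 0" using nz[of "lead_coeff p"] \<open>p \<noteq> 0\<close> by auto
    then have "map_poly e p \<noteq> 0" using coeff[OF e(1), of p "degree p"] by auto
    then obtain x where "poly (map_poly e p) x \<noteq> 0" using poly_all_0_iff_0 by blast
    then show ?thesis using e(1) by (auto simp: hom_poly_conv_poly[OF hom])
  qed
  have null': "F dvd G"
    if F: "irreducible F" and van: "\<And>e x. e \<in> E \<Longrightarrow> hom_poly e x F = 0 \<Longrightarrow> hom_poly e x G = 0" for F G
  proof (cases "degree F = 0")
    case True
    then obtain f where f: "F = [:f:]" by (elim degree_eq_zeroE)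
    have irr: "irreducible f" using F unfolding f by (simp add: irreducible_const_poly_iff)
    have "f dvd coeff G n" for n
    proof (rule null[OF irr])
      fix e assume e: "e \<in> E" "e f = 0"
      then have "poly (map_poly e G) x = 0" for x
        using van[OF e(1), of x] by (simp add: f hom_poly_const hom flip: hom_poly_conv_poly)
      then have "map_poly e G = 0" using poly_all_0_iff_0 by blast
      then show "e (coeff G n) = 0" using coeff[OF e(1), of G n] by simp
    qed
    then show ?thesis unfolding f by (simp add: const_poly_dvd_iff)
  next
    case False
    show ?thesis
    proof (rule ccontr)
      assume nd: "\<not> F dvd G"
      have "prime_elem F" using F by (simp add: prime_elem_iff_irreducible)
      then obtain a b r where r: "r \<noteq> 0" "a * F + b * G = [:r:]"
        using prime_elem_bezout_const[of F G] nd False by blast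
      have "lead_coeff F \<noteq> 0" using False by auto
      then obtain e where e: "e \<in> E" "e (r * lead_coeff F) \<noteq> 0"
        using nz[of "r * lead_coeff F"] r(1) by auto
      note he = hom[OF e(1)]
      have e': "e r \<noteq> 0" "e (lead_coeff F) \<noteq> 0" using e(2) by (auto simp: unital_hom_mult[OF he])
      have "degree (map_poly e F) \<noteq> 0"
        using le_degree[of "map_poly e F" "degree F"] e'(2) False coeff[OF e(1), of F "degree F"]
        by auto
      then obtain x where x: "poly (map_poly e F) x = 0"
        using fundamental_theorem_of_algebra constant_degree by metis
      note hx = unital_hom_hom_poly[OF he, of x]
      have F0: "hom_poly e x F = 0" using x by (simp add: hom_poly_conv_poly[OF he])
      have "hom_poly e x (a * F + b * G) = 0"
        using F0 van[OF e(1) F0] by (simp add: unital_hom_add[OF hx] unital_hom_mult[OF hx])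
      then show False using e'(1) by (simp add: r(2) hom_poly_const[OF he])
    qed
  qed
  show ?thesis unfolding vanishing_test_def
  proof (intro conjI allI impI ballI)
    fix e assume "e \<in> {hom_poly e x | e x. e \<in> E}"
    then show "unital_hom e" using hom unital_hom_hom_poly by blast
  next
    fix p :: "'a poly" assume "p \<noteq> 0"
    then show "\<exists>e\<in>{hom_poly e x | e x. e \<in> E}. e p \<noteq> 0" using nz' by blast
  next
    fix f g :: "'a poly"
    assume "irreducible f" "\<forall>e\<in>{hom_poly e x | e x. e \<in> E}. e f = 0 \<longrightarrow> e g = 0"
    then show "f dvd g" by (intro null') blast+
  qed
qed

lemma vanishing_test_complex: "vanishing_test {\<lambda>c. c}"
  by (auto simp: vanishing_test_def unital_hom_ident irreducible_def dvd_field_iff)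

lemma vanishing_test_value_at: "vanishing_test {\<lambda>F. value_at F v | v. True}"
proof -
  have "vanishing_test {hom_poly e1 a | e1 a. e1 \<in> {hom_poly e2 b | e2 b. e2 \<in>
      {hom_poly e3 c | e3 c. e3 \<in> {\<lambda>c. c}}}}" (is "vanishing_test ?E")
    by (intro vanishing_test_poly vanishing_test_complex)
  also have "?E = {\<lambda>F. value_at F v | v. True}"
  proof (intro set_eqI iffI)
    fix e assume "e \<in> ?E"
    then obtain a b c where "e = hom_poly (hom_poly (hom_poly (\<lambda>c. c) c) b) a" by blast
    then have "e = (\<lambda>F. value_at F (vector [a, b, c]))"
      by (simp add: eval3_conv_hom_poly fun_eq_iff)
    then show "e \<in> {\<lambda>F. value_at F v | v. True}" by blast
  qed (auto simp: eval3_conv_hom_poly)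
  finally show ?thesis .
qed

lemma irreducible_dvd_if_vanishes:
  assumes "irreducible F" "\<And>v. value_at F v = 0 \<Longrightarrow> value_at G v = 0"
  shows "F dvd G"
  using vanishing_test_value_at assms unfolding vanishing_test_def by blast

lemma dvd_imp_vanishes: "F dvd G \<Longrightarrow> value_at F v = 0 \<Longrightarrow> value_at G v = 0"
  using unital_hom_dvd[OF unital_hom_eval3[OF unital_hom_ident]] by (metis dvd_0_left_iff)

lemma dvd_all_xyz_imp_unit:
  assumes "\<And>i. h dvd xyz $ i"
  shows "is_unit h"
proof -
  have "h dvd [:[:0, 1:]:]" using assms[of 2] by (simp add: xyz_nth)
  then have "degree h = 0" using dvd_imp_degree_le[of h "[:[:0, 1:]:]"] by simp
  then obtain f where f: "h = [:f:]" by (elim degree_eq_zeroE)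
  have "[:f:] dvd [:0, 1:]" using assms[of 1] by (simp add: xyz_nth f)
  then have "f dvd coeff [:0, 1:] 1" unfolding const_poly_dvd_iff by blast
  then show ?thesis by (simp add: f is_unit_const_poly_iff)
qed

lemma value_at_0: "homogeneous d F \<Longrightarrow> d > 0 \<Longrightarrow> value_at F 0 = 0"
  using homogeneous_eval3_scale[of d F "\<lambda>c. c" 0 0] by (simp add: unital_hom_ident power_0_left)

lemma irreducible_dvd_xyz_multiples:
  assumes "irreducible F" "\<And>i. F dvd xyz $ i * G"
  shows "F dvd G"
proof (rule ccontr)
  assume "\<not> F dvd G"
  then have "F dvd xyz $ i" for i
    using prime_elem_dvd_multD[of F "xyz $ i" G] assms(1) assms(2)[of i]
    by (simp add: prime_elem_iff_irreducible)
  then have "is_unit F" by (rule dvd_all_xyz_imp_unit)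
  then show False using assms(1) by (simp add: irreducible_def)
qed

text \<open>The origin is no point of the plane. To be allowed to leave it out, the
  Nullstellensatz is applied to the multiples of \<open>G\<close> by the coordinates, which
  vanish there.\<close>

lemma irreducible_form_dvd_iff:
  assumes F: "irreducible F" and G: "homogeneous d G"
  shows "F dvd G \<longleftrightarrow> (\<forall>v. v \<noteq> 0 \<longrightarrow> value_at F v = 0 \<longrightarrow> value_at G v = 0)"
proof
  assume van: "\<forall>v. v \<noteq> 0 \<longrightarrow> value_at F v = 0 \<longrightarrow> value_at G v = 0"
  show "F dvd G"
  proof (rule irreducible_dvd_xyz_multiples[OF F], rule irreducible_dvd_if_vanishes[OF F])
    fix i v assume v: "value_at F v = 0"
    show "value_at (xyz $ i * G) v = 0"
      using v van by (cases "v = 0")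
        (auto simp: unital_hom_mult[OF unital_hom_eval3] unital_hom_ident eval3_xyz)
  qed
qed (auto intro: dvd_imp_vanishes)

section \<open>Proper images in terms of divisibility\<close>

lemma proj_eq_iff: "v \<noteq> 0 \<Longrightarrow> w \<noteq> 0 \<Longrightarrow> proj v = proj w \<longleftrightarrow> (\<exists>c. w = c *s v)"
  using Quotient3_rel[OF Quotient3_proj_plane, of v w]
  by (auto simp: proportional_def intro: exI[of _ 1])

lemma proj_surj: obtains v where "v \<noteq> 0" "p = proj v"
  using Quotient3_rep_reflp[OF Quotient3_proj_plane, of p]
    Quotient3_abs_rep[OF Quotient3_proj_plane, of p]
  by (metis proportional_def)

lemma unital_hom_value_at: "unital_hom (\<lambda>F. value_at F v)"
  by (intro unital_hom_eval3 unital_hom_ident)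

lemmas value_at_simps = unital_hom_mult[OF unital_hom_value_at] unital_hom_add[OF unital_hom_value_at]
  unital_hom_simps[OF unital_hom_value_at] eval3_xyz[OF unital_hom_ident] eval3_const3[OF unital_hom_ident]

lemma proj_in_zero_locus:
  assumes "homogeneous d F" "v \<noteq> 0"
  shows "proj v \<in> zero_locus F \<longleftrightarrow> value_at F v = 0"
proof
  assume "proj v \<in> zero_locus F"
  then obtain w where w: "w \<noteq> 0" "proj v = proj w" "value_at F w = 0"
    by (auto simp: zero_locus_def)
  then obtain c where "v = c *s w" using proj_eq_iff[of w v] assms by auto
  then show "value_at F v = 0"
    using w(3) by (simp add: homogeneous_eval3_scale[OF assms(1) unital_hom_ident])
qed (use assms in \<open>auto simp: zero_locus_def\<close>)

lemma irreducible_plane_curveE: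
  assumes "irreducible_plane_curve F"
  obtains d where "d > 0" "homogeneous d F" "irreducible F" "prime_elem F" "F \<noteq> 0" "\<not> is_unit F"
    "curve_degree F = d"
proof -
  obtain d where d: "homogeneous d F" and irr: "irreducible F"
    using assms by (auto simp: irreducible_plane_curve_def)
  have nz: "F \<noteq> 0" "\<not> is_unit F" using irr by (auto simp: irreducible_def)
  have "d > 0" using homogeneous_0_unit[of F] d nz by (cases d) auto
  then show ?thesis using that d irr nz curve_degree_eq by (simp add: prime_elem_iff_irreducible)
qed

lemma value_at_subst: "value_at (eval3 const3 G \<phi>) v = value_at G (map_value \<phi> v)"
  by (simp add: eval3_subst3 unital_hom_ident map_value_def)

lemma map_image_subset_zero_locus:
  assumes C: "irreducible_plane_curve C" and \<phi>: "\<And>i. homogeneous e (\<phi> $ i)"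
    and G: "homogeneous d G" and d: "d > 0"
  shows "map_image \<phi> (zero_locus C) \<subseteq> zero_locus G \<longleftrightarrow> C dvd eval3 const3 G \<phi>"
proof -
  obtain c where c: "c > 0" "homogeneous c C" "irreducible C"
    using C by (rule irreducible_plane_curveE)
  have "map_image \<phi> (zero_locus C) \<subseteq> zero_locus G \<longleftrightarrow>
      (\<forall>v. v \<noteq> 0 \<longrightarrow> value_at C v = 0 \<longrightarrow> map_value \<phi> v \<noteq> 0 \<longrightarrow> value_at G (map_value \<phi> v) = 0)"
  proof
    assume sub: "map_image \<phi> (zero_locus C) \<subseteq> zero_locus G"
    show "\<forall>v. v \<noteq> 0 \<longrightarrow> value_at C v = 0 \<longrightarrow> map_value \<phi> v \<noteq> 0 \<longrightarrow> value_at G (map_value \<phi> v) = 0"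
    proof (intro allI impI)
      fix v assume v: "v \<noteq> 0" "value_at C v = 0" "map_value \<phi> v \<noteq> 0"
      then have "proj (map_value \<phi> v) \<in> zero_locus G"
        using sub proj_in_zero_locus[OF c(2)] unfolding map_image_def by blast
      then show "value_at G (map_value \<phi> v) = 0" using proj_in_zero_locus[OF G v(3)] by simp
    qed
  qed (auto simp: map_image_def proj_in_zero_locus[OF c(2)] proj_in_zero_locus[OF G])
  also have "\<dots> \<longleftrightarrow> (\<forall>v. v \<noteq> 0 \<longrightarrow> value_at C v = 0 \<longrightarrow> value_at (eval3 const3 G \<phi>) v = 0)"
    using value_at_0[OF G d] by (metis value_at_subst)
  also have "\<dots> \<longleftrightarrow> C dvd eval3 const3 G \<phi>"
    by (rule irreducible_form_dvd_iff[OF c(3) homogeneous_subst3[OF G \<phi>], symmetric])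
  finally show ?thesis .
qed

lemma zariski_closure_subset:
  assumes "homogeneous d G"
  shows "zariski_closure S \<subseteq> zero_locus G \<longleftrightarrow> S \<subseteq> zero_locus G"
proof -
  have "S \<subseteq> zariski_closure S" unfolding zariski_closure_def by blast
  then show ?thesis using assms unfolding zariski_closure_def by blast
qed

lemma zero_locus_subset_iff:
  assumes B: "irreducible_plane_curve B" and G: "homogeneous d G"
  shows "zero_locus B \<subseteq> zero_locus G \<longleftrightarrow> B dvd G"
proof -
  obtain b where b: "homogeneous b B" "irreducible B" using B by (rule irreducible_plane_curveE)
  have "zero_locus B \<subseteq> zero_locus G \<longleftrightarrow> (\<forall>v. v \<noteq> 0 \<longrightarrow> value_at B v = 0 \<longrightarrow> value_at G v = 0)"
  proof
    assume s: "zero_locus B \<subseteq> zero_locus G"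
    show "\<forall>v. v \<noteq> 0 \<longrightarrow> value_at B v = 0 \<longrightarrow> value_at G v = 0"
      using s proj_in_zero_locus[OF b(1)] proj_in_zero_locus[OF G] by blast
  qed (auto simp: zero_locus_def)
  then show ?thesis by (simp add: irreducible_form_dvd_iff[OF b(2) G])
qed

text \<open>Algebraic form of the statement that \<open>B\<close> is the proper image of
  \<open>C\<close> under \<open>\<phi>\<close>. Unlike the geometric one it makes sense for
  coordinates with common factors, and it is transitive by a computation.\<close>

definition pulls_back :: "poly3 ^ 3 \<Rightarrow> poly3 \<Rightarrow> poly3 \<Rightarrow> bool" where
  "pulls_back \<phi> C B \<longleftrightarrow> (\<forall>d G. homogeneous d G \<longrightarrow> (B dvd G \<longleftrightarrow> C dvd eval3 const3 G \<phi>))"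

text \<open>If \<open>C\<close> divides every component of the map, the pullback of every
  coordinate is a multiple of \<open>C\<close>, so the target curve would lie on all three
  coordinate lines.\<close>

lemma pulls_back_xyz:
  assumes "pulls_back \<phi> C B" "\<not> is_unit B" "\<And>i. C dvd \<phi> $ i" shows False
proof -
  have "B dvd xyz $ i" for i
    using assms homogeneous_xyz[of i] by (auto simp: pulls_back_def eval3_xyz unital_hom_const3)
  then show False using dvd_all_xyz_imp_unit assms(2) by blast
qed

lemma nonunit_dvd_const_iff:
  assumes "homogeneous 0 G" "\<not> is_unit P" shows "P dvd G \<longleftrightarrow> G = 0"
  using assms homogeneous_0_unit dvd_unit_imp_unit dvd_0_right by metis

text \<open>A form vanishes on the Zariski closure of the image iff it vanishes on the image,
  iff its pullback vanishes on \<open>C\<close>; the Nullstellensatz for \<open>B\<close> and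
  \<open>C\<close> turns vanishing into divisibility. Constant forms are treated apart, because
  only forms of positive degree vanish automatically where all components of
  \<open>\<phi>\<close> vanish.\<close>

lemma is_proper_image_iff:
  assumes C: "irreducible_plane_curve C" and B: "irreducible_plane_curve B"
    and \<phi>: "\<And>i. homogeneous e (\<phi> $ i)"
  shows "is_proper_image \<phi> C B \<longleftrightarrow> pulls_back \<phi> C B"
proof
  let ?S = "map_image \<phi> (zero_locus C)"
  obtain b where b: "homogeneous b B" "\<not> is_unit B" "B \<noteq> 0" using B by (rule irreducible_plane_curveE)
  obtain c where c: "\<not> is_unit C" "C \<noteq> 0" using C by (rule irreducible_plane_curveE)
  {
    assume im: "is_proper_image \<phi> C B"
    show "pulls_back \<phi> C B" unfolding pulls_back_def
    proof (intro allI impI)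
      fix d G assume G: "homogeneous d G"
      show "B dvd G \<longleftrightarrow> C dvd eval3 const3 G \<phi>"
      proof (cases "d = 0")
        case True
        then obtain a where a: "G = const3 a" using homogeneous_0_const G by blast
        have "C dvd G \<longleftrightarrow> G = 0" "B dvd G \<longleftrightarrow> G = 0"
          using nonunit_dvd_const_iff b(2) c(1) G True by blast+
        then show ?thesis by (simp add: a eval3_const3 unital_hom_const3)
      next
        case False
        have "B dvd G \<longleftrightarrow> zariski_closure ?S \<subseteq> zero_locus G"
          using im zero_locus_subset_iff[OF B G] by (simp add: is_proper_image_def)
        also have "\<dots> \<longleftrightarrow> C dvd eval3 const3 G \<phi>"
          unfolding zariski_closure_subset[OF G]
          using map_image_subset_zero_locus[OF C \<phi> G] False by simp
        finally show ?thesis .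
      qed
    qed
  }
  assume pb: "pulls_back \<phi> C B"
  have sub: "?S \<subseteq> zero_locus G \<longleftrightarrow> B dvd G" if G: "homogeneous d G" for d G
  proof (cases "d = 0")
    case False
    then show ?thesis
      using map_image_subset_zero_locus[OF C \<phi> G] G pb by (auto simp: pulls_back_def)
  next
    case True
    show ?thesis
    proof (cases "G = 0")
      case True
      have "x \<in> zero_locus 0" for x
        using proj_surj[of x] unfolding zero_locus_def by (auto simp: value_at_simps)
      then show ?thesis using True by auto
    next
      case False
      have unit: "is_unit G" using homogeneous_0_unit G True False by blast
      have "value_at G v \<noteq> 0" for v
        using unital_hom_dvd[OF unital_hom_value_at[of v] unit]
        by (auto simp: unital_hom_1[OF unital_hom_value_at])
      then have "zero_locus G = {}" by (auto simp: zero_locus_def)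
      moreover have "?S \<noteq> {}"
      proof
        assume "?S = {}"
        then have "C dvd eval3 const3 (xyz $ i) \<phi>" for i
          using map_image_subset_zero_locus[OF C \<phi> homogeneous_xyz[of i]] by simp
        then show False
          using pulls_back_xyz[OF pb b(2)] by (simp add: eval3_xyz unital_hom_const3)
      qed
      ultimately show ?thesis using b(2) nonunit_dvd_const_iff G False \<open>d = 0\<close> by blast
    qed
  qed
  have "zariski_closure ?S = zero_locus B"
  proof
    show "zariski_closure ?S \<subseteq> zero_locus B"
      unfolding zariski_closure_subset[OF b(1)] using sub[OF b(1)] by simp
    show "zero_locus B \<subseteq> zariski_closure ?S"
      unfolding zariski_closure_def
      using sub zero_locus_subset_iff[OF B] by (simp add: le_Inf_iff) blast
  qed
  then show "is_proper_image \<phi> C B" by (simp add: is_proper_image_def)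
qed

text \<open>If the image were one point, all lines through that point would contain the image
  and hence \<open>B\<close>; two different lines do not contain a common curve.\<close>

lemma not_contracts:
  assumes C: "irreducible_plane_curve C" and B: "irreducible_plane_curve B"
    and \<phi>: "\<And>i. homogeneous e (\<phi> $ i)" and pb: "pulls_back \<phi> C B"
  shows "\<not> contracts \<phi> C"
proof
  assume "contracts \<phi> C"
  then obtain q where q: "map_image \<phi> (zero_locus C) \<subseteq> {q}" by (auto simp: contracts_def)
  obtain w where w: "w \<noteq> 0" "q = proj w" by (rule proj_surj)
  obtain b where b: "b > 0" "homogeneous b B" "B \<noteq> 0" using B by (rule irreducible_plane_curveE)
  define l where "l i j = const3 (w $ i) * xyz $ j - const3 (w $ j) * xyz $ i" for i j
  have l1: "homogeneous 1 (l i j)" for i j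
  proof -
    have "l i j = const3 (w $ i) * xyz $ j + const3 (- w $ j) * xyz $ i"
      by (simp add: l_def unital_hom_minus[OF unital_hom_const3])
    moreover have "homogeneous (0 + 1) (const3 (w $ i) * xyz $ j + const3 (- w $ j) * xyz $ i)"
      by (intro homogeneous_add homogeneous_mult homogeneous_const3 homogeneous_xyz)
    ultimately show ?thesis by simp
  qed
  have lv: "value_at (l i j) v = w $ i * v $ j - w $ j * v $ i" for i j v
    by (simp add: l_def value_at_simps)
  have "proj w \<in> zero_locus (l i j)" for i j
    using w(1) by (auto simp: proj_in_zero_locus[OF l1] lv)
  then have "map_image \<phi> (zero_locus C) \<subseteq> zero_locus (l i j)" for i j using q w(2) by auto
  then have "B dvd l i j" for i j
    using map_image_subset_zero_locus[OF C \<phi> l1 zero_less_one] pb l1 unfolding pulls_back_def by blast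
  then obtain Q where Q: "l i j = B * Q i j" for i j unfolding dvd_def by metis
  obtain i where i: "w $ i \<noteq> 0" using w(1) by (auto simp: vec_eq_iff)
  obtain j k where jk: "j \<noteq> i" "k \<noteq> i" "j \<noteq> (k::3)"
  proof -
    have "i = 1 \<or> i = 2 \<or> i = 3" by (rule exhaust_3)
    then show ?thesis using that[of 2 3] that[of 1 3] that[of 1 2] by auto
  qed
  have vj: "value_at (l i j) (axis j 1) \<noteq> 0" "value_at (l i k) (axis j 1) = 0"
      "value_at (l i k) (axis k 1) \<noteq> 0"
    using jk i by (simp_all add: lv axis_def)
  have lk: "l i k \<noteq> 0" using vj(3) by (auto simp: value_at_simps)
  have "B * Q i k \<noteq> 0" using lk Q[of i k] by simp
  then obtain e where e: "homogeneous e (Q i k)"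
    using homogeneous_factor[of 1 "Q i k" B] l1[of i k] Q[of i k] by (auto simp: mult.commute)
  have "b + e = 1"
    using homogeneous_unique[OF homogeneous_mult[OF b(2) e], of 1] l1[of i k] Q[of i k] lk by simp
  then have "e = 0" using b(1) by simp
  then obtain a where a: "Q i k = const3 a" using e homogeneous_0_const by blast
  have "value_at B (axis j 1) \<noteq> 0" using vj(1) by (auto simp: Q value_at_simps)
  then have "a = 0" using vj(2) by (auto simp: Q a value_at_simps)
  then show False using lk Q[of i k] a by (simp add: const3_def)
qed

section \<open>Composition of plane birational maps\<close>

lemma compose_map_nth: "compose_map \<psi> \<phi> $ i = eval3 const3 (\<psi> $ i) \<phi>"
  by (simp add: compose_map_def const3_eq)

lemma subst3_scale: "homogeneous d F \<Longrightarrow> eval3 const3 F (s *s a) = s ^ d * eval3 const3 F a"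
  by (rule homogeneous_eval3_scale) (simp_all add: unital_hom_const3)

lemma subst3_subst3: "eval3 const3 (eval3 const3 F b) a = eval3 const3 F (compose_map b a)"
  by (simp add: eval3_subst3 unital_hom_const3 compose_map_def const3_eq)

definition form_map :: "poly3 ^ 3 \<Rightarrow> bool" where
  "form_map \<phi> \<longleftrightarrow> (\<exists>e. \<forall>i. homogeneous e (\<phi> $ i))"

text \<open>Mutually inverse birational maps given by forms that may have common factors. Such
  pairs can be composed without cancelling anything.\<close>

definition mutually_inverse :: "poly3 ^ 3 \<Rightarrow> poly3 ^ 3 \<Rightarrow> bool" where
  "mutually_inverse \<phi> \<psi> \<longleftrightarrow> form_map \<phi> \<and> form_map \<psi> \<and>
     (\<exists>h. h \<noteq> 0 \<and> compose_map \<psi> \<phi> = h *s xyz) \<and> (\<exists>h. h \<noteq> 0 \<and> compose_map \<phi> \<psi> = h *s xyz)"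

lemma mutually_inverse_sym: "mutually_inverse \<phi> \<psi> \<Longrightarrow> mutually_inverse \<psi> \<phi>"
  by (auto simp: mutually_inverse_def)

lemma xyz_nonzero: "xyz $ i \<noteq> 0"
  using exhaust_3[of i] by (auto simp: xyz_nth)

text \<open>Cross-multiplication eliminates \<open>P\<close>; then \<open>x\<close> divides
  \<open>v\<^sub>1 y\<close> and hence \<open>v\<^sub>1\<close>.\<close>

lemma multiple_of_xyz:
  assumes eq: "\<And>i. P * v $ i = h * xyz $ i" and h: "h \<noteq> (0::poly3)"
  shows "\<exists>k. k \<noteq> 0 \<and> v = k *s xyz"
proof -
  have P: "P \<noteq> 0" using eq[of 1] h xyz_nonzero[of 1] by auto
  have "P * (v $ 1 * xyz $ 2) = P * (v $ 2 * xyz $ 1)"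
    using arg_cong[OF eq[of 1], of "\<lambda>t. t * xyz $ 2"] arg_cong[OF eq[of 2], of "\<lambda>t. t * xyz $ 1"]
    by (simp only: mult_ac)
  then have "v $ 1 * xyz $ 2 = v $ 2 * xyz $ 1" using P by simp
  then have "coeff (v $ 1 * xyz $ 2) 0 = 0" by (simp add: xyz_nth coeff_mult_0)
  then have "coeff (v $ 1) 0 = 0" by (simp add: xyz_nth coeff_mult_0)
  then obtain k where k: "v $ 1 = k * xyz $ 1"
    by (cases "v $ 1") (auto simp: xyz_nth)
  then have "(P * k) * xyz $ 1 = h * xyz $ 1" using eq[of 1] by (simp only: mult.assoc)
  then have Pk: "P * k = h" using xyz_nonzero[of 1] by simp
  have "P * v $ i = P * (k * xyz $ i)" for i using eq[of i] Pk by (simp only: mult.assoc[symmetric])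
  then have "v = k *s xyz" using P by (simp add: vec_eq_iff)
  then show ?thesis using Pk h by auto
qed

lemma mutually_inverse_nonzero:
  assumes "mutually_inverse \<phi> \<psi>" shows "\<phi> \<noteq> 0"
proof
  assume \<phi>: "\<phi> = 0"
  obtain h where h: "h \<noteq> 0" "compose_map \<phi> \<psi> = h *s xyz"
    using assms by (auto simp: mutually_inverse_def)
  have "compose_map \<phi> \<psi> $ 1 = 0"
    by (simp add: \<phi> compose_map_nth unital_hom_0[OF unital_hom_eval3[OF unital_hom_const3]])
  then show False using xyz_nonzero[of 1] h by simp
qed

lemma divide_out_gcd:
  assumes "form_map \<phi>" "\<phi> \<noteq> 0"
  shows "\<exists>g \<phi>'. g \<noteq> 0 \<and> \<phi> = g *s \<phi>' \<and> rational_map \<phi>'"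
proof -
  obtain e where e: "homogeneous e (\<phi> $ i)" for i using assms by (auto simp: form_map_def)
  define g where "g = gcd (\<phi> $ 1) (gcd (\<phi> $ 2) (\<phi> $ 3))"
  have gd: "g dvd \<phi> $ i" for i
    using exhaust_3[of i] by (auto simp: g_def intro: dvd_trans[OF gcd_dvd2])
  define \<phi>' where "\<phi>' = (\<chi> i. \<phi> $ i div g)"
  obtain i0 where i0: "\<phi> $ i0 \<noteq> 0" using assms(2) by (auto simp: vec_eq_iff)
  then have g: "g \<noteq> 0" using gd[of i0] by auto
  have eq: "\<phi> $ i = g * \<phi>' $ i" for i using gd by (simp add: \<phi>'_def)
  obtain k where k: "homogeneous k g" using homogeneous_dvd[OF e i0 gd] by blast
  have "homogeneous (e - k) (\<phi>' $ i)" for i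
  proof (cases "\<phi> $ i = 0")
    case True
    then show ?thesis using eq[of i] g by simp
  next
    case False
    then obtain m where m: "homogeneous m (\<phi>' $ i)"
      using homogeneous_factor[of e "\<phi>' $ i" g] e[of i] eq[of i] by (auto simp: mult.commute)
    then have "k + m = e"
      using homogeneous_unique[OF homogeneous_mult[OF k m], of e] e[of i] eq[of i] False by simp
    then show ?thesis using m by auto
  qed
  moreover have "h dvd 1" if h: "\<And>i. h dvd \<phi>' $ i" for h
  proof -
    have "g * h dvd \<phi> $ i" for i using h[of i] eq[of i] by (simp add: mult_dvd_mono)
    then have "g * h dvd g * 1" by (simp add: g_def)
    then show ?thesis using g dvd_mult_cancel_left by blast
  qed
  moreover have "\<phi>' \<noteq> 0" using i0 eq[of i0] by auto
  ultimately have "rational_map \<phi>'" unfolding rational_map_def by blast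
  then show ?thesis using g eq by (intro exI[of _ g] exI[of _ \<phi>']) (simp add: vec_eq_iff)
qed

text \<open>Removing the common factors \<open>g\<close> and \<open>k\<close> divides the
  composite by a factor common to its components.\<close>

lemma mutually_inverse_reduce:
  assumes inv: "mutually_inverse (g *s \<phi>) (k *s \<psi>)" and \<phi>: "rational_map \<phi>" and \<psi>: "rational_map \<psi>"
  shows "\<exists>h. h \<noteq> 0 \<and> compose_map \<psi> \<phi> = h *s xyz"
proof -
  obtain h where h: "h \<noteq> 0" "compose_map (k *s \<psi>) (g *s \<phi>) = h *s xyz"
    using inv by (auto simp: mutually_inverse_def)
  obtain e where e: "homogeneous e (\<psi> $ i)" for i using \<psi> by (auto simp: rational_map_def)
  have "eval3 const3 k (g *s \<phi>) * g ^ e * compose_map \<psi> \<phi> $ i = h * xyz $ i" for i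
  proof -
    have "h * xyz $ i = compose_map (k *s \<psi>) (g *s \<phi>) $ i" by (simp add: h)
    also have "\<dots> = eval3 const3 k (g *s \<phi>) * eval3 const3 (\<psi> $ i) (g *s \<phi>)"
      by (simp add: compose_map_nth unital_hom_mult[OF unital_hom_eval3[OF unital_hom_const3]])
    also have "eval3 const3 (\<psi> $ i) (g *s \<phi>) = g ^ e * compose_map \<psi> \<phi> $ i"
      by (simp add: subst3_scale[OF e] compose_map_nth)
    finally show ?thesis by (simp add: mult.assoc)
  qed
  then show ?thesis using multiple_of_xyz h(1) by blast
qed

text \<open>Pulling back \<open>G\<close> along \<open>\<psi>\<close> and then along
  \<open>\<phi>\<close> multiplies it by a power of \<open>h\<close>, and \<open>C\<close> does
  not divide \<open>h\<close> because \<open>B\<close> does not divide all components of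
  \<open>\<psi>\<close>.\<close>

lemma pulls_back_inverse:
  assumes inv: "mutually_inverse \<phi> \<psi>" and \<psi>: "rational_map \<psi>"
    and C: "irreducible_plane_curve C" and B: "irreducible_plane_curve B" and pb: "pulls_back \<phi> C B"
  shows "pulls_back \<psi> B C"
  unfolding pulls_back_def
proof (intro allI impI)
  fix d G assume G: "homogeneous d G"
  obtain h where h: "compose_map \<psi> \<phi> = h *s xyz" using inv by (auto simp: mutually_inverse_def)
  obtain e where e: "\<And>i. homogeneous e (\<psi> $ i)" using \<psi> by (auto simp: rational_map_def)
  have primeC: "prime_elem C" using C by (rule irreducible_plane_curveE)
  have unitB: "\<not> is_unit B" using B by (rule irreducible_plane_curveE)
  have "\<not> C dvd h"
  proof
    assume "C dvd h"
    then have "C dvd compose_map \<psi> \<phi> $ i" for i by (simp add: h)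
    then have "B dvd \<psi> $ i" for i using pb e by (auto simp: pulls_back_def compose_map_nth)
    then show False using \<psi> unitB by (auto simp: rational_map_def)
  qed
  then have ndvd: "\<not> C dvd h ^ d" using primeC prime_elem_dvd_power by blast
  have "B dvd eval3 const3 G \<psi> \<longleftrightarrow> C dvd eval3 const3 G (h *s xyz)"
    using pb homogeneous_subst3[OF G e] by (simp add: pulls_back_def subst3_subst3 h)
  also have "\<dots> \<longleftrightarrow> C dvd h ^ d * G" by (simp add: subst3_scale[OF G] eval3_const3_xyz)
  also have "\<dots> \<longleftrightarrow> C dvd G" using ndvd primeC prime_elem_dvd_mult_iff by blast
  finally show "C dvd G \<longleftrightarrow> B dvd eval3 const3 G \<psi>" by simp
qed

text \<open>The common factors of the components are cancelled only here. The factor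
  \<open>g\<close> is not a multiple of \<open>C\<close>, so cancelling it does not change which
  pullbacks are multiples of \<open>C\<close>. The conditions on the inverse map and the absence
  of contraction come for free.\<close>

lemma cremona_equivalentI:
  assumes C: "irreducible_plane_curve C" and B: "irreducible_plane_curve B"
    and inv: "mutually_inverse \<phi> \<psi>" and pb: "pulls_back \<phi> C B"
  shows "cremona_equivalent C B"
proof -
  note inv' = mutually_inverse_sym[OF inv]
  have "form_map \<phi>" "form_map \<psi>" using inv by (auto simp: mutually_inverse_def)
  then obtain g \<phi>' k \<psi>' where g: "g \<noteq> 0" "\<phi> = g *s \<phi>'" and k: "k \<noteq> 0" "\<psi> = k *s \<psi>'"
    and r: "rational_map \<phi>'" "rational_map \<psi>'"
    using divide_out_gcd mutually_inverse_nonzero[OF inv] mutually_inverse_nonzero[OF inv'] by metis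
  have i1: "\<exists>h. h \<noteq> 0 \<and> compose_map \<psi>' \<phi>' = h *s xyz"
    using mutually_inverse_reduce inv r unfolding g(2) k(2) by blast
  have i2: "\<exists>h. h \<noteq> 0 \<and> compose_map \<phi>' \<psi>' = h *s xyz"
    using mutually_inverse_reduce inv' r unfolding g(2) k(2) by blast
  have invr: "mutually_inverse \<phi>' \<psi>'"
    using i1 i2 r unfolding mutually_inverse_def form_map_def rational_map_def by blast
  have primeC: "prime_elem C" using C by (rule irreducible_plane_curveE)
  have unitB: "\<not> is_unit B" using B by (rule irreducible_plane_curveE)
  have nd: "\<not> C dvd g"
  proof
    assume "C dvd g"
    then have "C dvd \<phi> $ i" for i by (simp add: g)
    then show False using pulls_back_xyz[OF pb unitB] by blast
  qed
  have pb': "pulls_back \<phi>' C B" unfolding pulls_back_def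
  proof (intro allI impI)
    fix d G assume G: "homogeneous d G"
    have "\<not> C dvd g ^ d" using nd primeC prime_elem_dvd_power by blast
    then have "C dvd g ^ d * eval3 const3 G \<phi>' \<longleftrightarrow> C dvd eval3 const3 G \<phi>'"
      using primeC prime_elem_dvd_mult_iff by blast
    then show "B dvd G \<longleftrightarrow> C dvd eval3 const3 G \<phi>'"
      using pb G by (simp add: pulls_back_def g subst3_scale[OF G])
  qed
  have pb2: "pulls_back \<psi>' B C" by (rule pulls_back_inverse[OF invr r(2) C B pb'])
  obtain e e' where e: "\<And>i. homogeneous e (\<phi>' $ i)" and e': "\<And>i. homogeneous e' (\<psi>' $ i)"
    using r by (auto simp: rational_map_def)
  show ?thesis unfolding cremona_equivalent_def inverse_birational_maps_def
    using C B r i1 i2 not_contracts[OF C B e pb'] not_contracts[OF B C e' pb2]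
      is_proper_image_iff[OF C B e] is_proper_image_iff[OF B C e'] pb' pb2 by blast
qed

lemma cremona_equivalentE:
  assumes "cremona_equivalent C B"
  obtains \<phi> \<psi> where "irreducible_plane_curve C" "irreducible_plane_curve B"
    "mutually_inverse \<phi> \<psi>" "pulls_back \<phi> C B"
proof -
  obtain \<phi> \<psi> where *: "irreducible_plane_curve C" "irreducible_plane_curve B"
     "inverse_birational_maps \<phi> \<psi>" "is_proper_image \<phi> C B"
    using assms by (auto simp: cremona_equivalent_def)
  have "mutually_inverse \<phi> \<psi>"
    using *(3) unfolding mutually_inverse_def inverse_birational_maps_def form_map_def rational_map_def
    by blast
  moreover obtain e where "\<And>i. homogeneous e (\<phi> $ i)"
    using *(3) by (auto simp: inverse_birational_maps_def rational_map_def)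
  then have "pulls_back \<phi> C B" using is_proper_image_iff[OF *(1,2)] *(4) by blast
  ultimately show ?thesis using that * by blast
qed

lemma form_map_compose:
  assumes "form_map \<psi>" "form_map \<phi>" shows "form_map (compose_map \<psi> \<phi>)"
proof -
  obtain e where "\<And>i. homogeneous e (\<psi> $ i)" using assms by (auto simp: form_map_def)
  moreover obtain e' where "\<And>i. homogeneous e' (\<phi> $ i)" using assms by (auto simp: form_map_def)
  ultimately show ?thesis unfolding form_map_def compose_map_nth using homogeneous_subst3 by blast
qed

lemma compose_map_assoc: "compose_map (compose_map \<chi>' \<psi>) \<phi> = compose_map \<chi>' (compose_map \<psi> \<phi>)"
  by (simp add: vec_eq_iff compose_map_nth subst3_subst3)

text \<open>A birational map is dominant: pulling back along the inverse map recovers the form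
  up to a nonzero factor.\<close>

lemma form_nonzero_subst:
  assumes "mutually_inverse \<phi> \<psi>" "homogeneous d F" "F \<noteq> 0"
  shows "eval3 const3 F \<phi> \<noteq> 0"
proof
  assume 0: "eval3 const3 F \<phi> = 0"
  obtain h where h: "h \<noteq> 0" "compose_map \<phi> \<psi> = h *s xyz"
    using assms by (auto simp: mutually_inverse_def)
  have "0 = eval3 const3 (eval3 const3 F \<phi>) \<psi>"
    by (simp add: 0 unital_hom_0[OF unital_hom_eval3[OF unital_hom_const3]])
  also have "\<dots> = h ^ d * F" by (simp add: subst3_subst3 h subst3_scale[OF assms(2)] eval3_const3_xyz)
  finally show False using h assms(3) by simp
qed

lemma common_multiplier_homogeneous:
  assumes "form_map v" "v = h *s xyz" "h \<noteq> 0"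
  shows "\<exists>d. homogeneous d h"
proof -
  obtain e where "homogeneous e (v $ 1)" using assms by (auto simp: form_map_def)
  then show ?thesis using homogeneous_factor[of e h "xyz $ 1"] assms xyz_nonzero[of 1] by auto
qed

lemma compose_inverse_step:
  assumes inv: "mutually_inverse \<phi> \<psi>" and inv2: "mutually_inverse \<alpha> \<beta>"
  shows "\<exists>h. h \<noteq> 0 \<and> compose_map (compose_map \<psi> \<beta>) (compose_map \<alpha> \<phi>) = h *s xyz"
proof -
  obtain h where h: "h \<noteq> 0" "compose_map \<psi> \<phi> = h *s xyz" using inv by (auto simp: mutually_inverse_def)
  obtain k where k: "k \<noteq> 0" "compose_map \<beta> \<alpha> = k *s xyz" using inv2 by (auto simp: mutually_inverse_def)
  obtain e where e: "\<And>i. homogeneous e (\<psi> $ i)"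
    using inv by (auto simp: mutually_inverse_def form_map_def)
  obtain d where "homogeneous d k"
    using common_multiplier_homogeneous[OF form_map_compose k(2,1)] inv2
    by (auto simp: mutually_inverse_def)
  then have k\<phi>: "eval3 const3 k \<phi> \<noteq> 0" using form_nonzero_subst[OF inv] k(1) by blast
  have "compose_map \<beta> (compose_map \<alpha> \<phi>) = eval3 const3 k \<phi> *s \<phi>"
    by (simp add: compose_map_assoc[symmetric] k vec_eq_iff)
       (simp add: compose_map_nth unital_hom_mult[OF unital_hom_eval3[OF unital_hom_const3]]
          eval3_xyz unital_hom_const3)
  then have "compose_map (compose_map \<psi> \<beta>) (compose_map \<alpha> \<phi>) = 
      compose_map \<psi> (eval3 const3 k \<phi> *s \<phi>)"
    by (simp add: compose_map_assoc)
  also have "\<dots> = (eval3 const3 k \<phi>) ^ e *s compose_map \<psi> \<phi>"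
    by (simp add: vec_eq_iff compose_map_nth subst3_scale[OF e])
  finally have "compose_map (compose_map \<psi> \<beta>) (compose_map \<alpha> \<phi>) = (eval3 const3 k \<phi> ^ e * h) *s xyz"
    by (simp add: h vector_smult_assoc)
  then show ?thesis using h k\<phi> by (intro exI[of _ "eval3 const3 k \<phi> ^ e * h"]) simp
qed

text \<open>Transitivity of Cremona equivalence, in the form needed for a single further map.\<close>

lemma cremona_equivalent_extend:
  assumes CB: "cremona_equivalent C B" and B': "irreducible_plane_curve B'"
    and inv2: "mutually_inverse \<alpha> \<beta>" and pb2: "pulls_back \<alpha> B B'"
  shows "cremona_equivalent C B'"
proof -
  obtain \<phi> \<psi> where *: "irreducible_plane_curve C" "irreducible_plane_curve B"
    "mutually_inverse \<phi> \<psi>" "pulls_back \<phi> C B" using CB by (rule cremona_equivalentE)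
  have "mutually_inverse (compose_map \<alpha> \<phi>) (compose_map \<psi> \<beta>)"
    using *(3) inv2 compose_inverse_step[OF *(3) inv2]
      compose_inverse_step[OF mutually_inverse_sym[OF inv2] mutually_inverse_sym[OF *(3)]]
    by (auto simp: mutually_inverse_def intro: form_map_compose)
  moreover have "pulls_back (compose_map \<alpha> \<phi>) C B'" unfolding pulls_back_def
  proof (intro allI impI)
    fix d G assume G: "homogeneous d G"
    obtain e where "\<And>i. homogeneous e (\<alpha> $ i)"
      using inv2 by (auto simp: mutually_inverse_def form_map_def)
    then have "homogeneous (d * e) (eval3 const3 G \<alpha>)" using homogeneous_subst3 G by blast
    then show "B' dvd G \<longleftrightarrow> C dvd eval3 const3 G (compose_map \<alpha> \<phi>)"
      using pb2 *(4) G unfolding pulls_back_def by (metis subst3_subst3)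
  qed
  ultimately show ?thesis using cremona_equivalentI *(1) B' by blast
qed

section \<open>The transform of a curve under a birational map\<close>

lemmas unital_hom_subst3 = unital_hom_eval3[OF unital_hom_const3]
lemmas subst3_simps = unital_hom_mult[OF unital_hom_subst3] unital_hom_add[OF unital_hom_subst3]
  unital_hom_simps[OF unital_hom_subst3] eval3_xyz[OF unital_hom_const3] eval3_const3[OF unital_hom_const3]

lemma prime_elem_dvd_hom_factor:
  fixes H :: "poly3 \<Rightarrow> poly3"
  assumes H: "unital_hom H" and B: "prime_elem B" and "R \<noteq> 0" "B dvd H R"
  shows "\<exists>P. irreducible P \<and> P dvd R \<and> B dvd H P"
  using assms(3,4)
proof (induction R rule: prime_divisors_induct)
  case zero
  then show ?case by simp
next
  case (unit x)
  then have "H x dvd 1" using unital_hom_dvd[OF H, of x 1] by (simp add: unital_hom_1[OF H])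
  then have "is_unit B" using unit dvd_trans by blast
  then show ?case using B by simp
next
  case (factor p x)
  have "B dvd H p \<or> B dvd H x"
    using factor.prems B by (simp add: unital_hom_mult[OF H] prime_elem_dvd_mult_iff)
  then show ?case
  proof
    assume "B dvd H p"
    then show ?thesis using factor.hyps by (intro exI[of _ p]) (auto simp: prime_elem_iff_irreducible)
  next
    assume "B dvd H x"
    then obtain P where "irreducible P" "P dvd x" "B dvd H P" using factor by auto
    then show ?thesis by (auto intro: dvd_mult)
  qed
qed

text \<open>The total transform of \<open>B\<close> pulls back to \<open>h\<^sup>d B\<close>, so
  \<open>B\<close> divides the pullback of one of its irreducible factors. This factor is the
  proper image, and it can be found in \<open>R\<close> because \<open>B\<close> does not divide
  the pullback of \<open>E\<close>. In the intended use \<open>E\<close> collects exceptional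
  lines, so that the degree of \<open>R\<close> bounds that of the new curve.\<close>

lemma transformed_curve:
  assumes B: "irreducible_plane_curve B" and inv: "mutually_inverse \<alpha> \<beta>"
    and h: "compose_map \<beta> \<alpha> = h *s xyz" "h \<noteq> 0" "\<not> B dvd h"
    and R: "eval3 const3 B \<beta> = E * R" and E: "\<not> B dvd eval3 const3 E \<alpha>"
  shows "\<exists>B'. irreducible_plane_curve B' \<and> B' dvd R \<and> pulls_back \<alpha> B B'"
proof -
  obtain d where d: "homogeneous d B" "prime_elem B" "B \<noteq> 0" "d > 0"
    using B by (rule irreducible_plane_curveE)
  obtain k where k: "k \<noteq> 0" "compose_map \<alpha> \<beta> = k *s xyz"
    using inv by (auto simp: mutually_inverse_def)
  obtain a where a: "\<And>i. homogeneous a (\<alpha> $ i)"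
    using inv by (auto simp: mutually_inverse_def form_map_def)
  obtain b where b: "\<And>i. homogeneous b (\<beta> $ i)"
    using inv by (auto simp: mutually_inverse_def form_map_def)
  have "eval3 const3 E \<alpha> * eval3 const3 R \<alpha> = eval3 const3 (eval3 const3 B \<beta>) \<alpha>"
    by (simp add: R subst3_simps)
  also have BB: "\<dots> = h ^ d * B"
    by (simp add: subst3_subst3 h(1) subst3_scale[OF d(1)] eval3_const3_xyz)
  finally have BR: "B dvd eval3 const3 R \<alpha>" using d(2) E prime_elem_dvd_multD by (metis dvd_triv_right)
  have nz: "eval3 const3 B \<beta> \<noteq> 0" using BB h(2) d(3) by (auto simp: subst3_simps)
  then have "R \<noteq> 0" using R by auto
  from prime_elem_dvd_hom_factor[OF unital_hom_subst3 d(2) this BR]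
  obtain B' where B': "irreducible B'" "B' dvd R" "B dvd eval3 const3 B' \<alpha>" by blast
  have "B' dvd eval3 const3 B \<beta>" using B'(2) R by simp
  then obtain e where e: "homogeneous e B'"
    using homogeneous_dvd[OF homogeneous_subst3[OF d(1) b] nz] by blast
  then have curve: "irreducible_plane_curve B'" using B' by (auto simp: irreducible_plane_curve_def)
  have prime': "prime_elem B'" using B'(1) by (simp add: prime_elem_iff_irreducible)
  \<comment> \<open>The new curve is not exceptional for the inverse map: \<open>k \<circ> \<alpha>\<close> is a power of \<open>h\<close>.\<close>
  have ndk: "\<not> B' dvd k"
  proof
    assume "B' dvd k"
    then have "eval3 const3 B' \<alpha> dvd eval3 const3 k \<alpha>" by (rule unital_hom_dvd[OF unital_hom_subst3])
    then have *: "B dvd eval3 const3 k \<alpha>" using B'(3) dvd_trans by blast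
    have eq: "eval3 const3 k \<alpha> * \<alpha> $ i = h ^ a * \<alpha> $ i" for i
    proof -
      have "eval3 const3 k \<alpha> * \<alpha> $ i = eval3 const3 ((compose_map \<alpha> \<beta>) $ i) \<alpha>"
        by (simp add: k subst3_simps)
      also have "\<dots> = eval3 const3 (\<alpha> $ i) (compose_map \<beta> \<alpha>)"
        by (simp add: compose_map_nth subst3_subst3)
      also have "\<dots> = h ^ a * \<alpha> $ i"
        by (simp add: h(1) subst3_scale[OF a] eval3_const3_xyz)
      finally show ?thesis .
    qed
    obtain i where "\<alpha> $ i \<noteq> 0" using mutually_inverse_nonzero[OF inv] by (auto simp: vec_eq_iff)
    then have "eval3 const3 k \<alpha> = h ^ a" using eq[of i] by simp
    then show False using * h(3) d(2) prime_elem_dvd_power by metis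
  qed
  have "pulls_back \<alpha> B B'" unfolding pulls_back_def
  proof (intro allI impI iffI)
    fix n G assume G: "homogeneous n G"
    show "B dvd eval3 const3 G \<alpha>" if "B' dvd G"
      using unital_hom_dvd[OF unital_hom_subst3 that] B'(3) dvd_trans by blast
    assume "B dvd eval3 const3 G \<alpha>"
    then have "eval3 const3 B \<beta> dvd eval3 const3 (eval3 const3 G \<alpha>) \<beta>"
      by (rule unital_hom_dvd[OF unital_hom_subst3])
    then have "B' dvd k ^ n * G"
      using \<open>B' dvd eval3 const3 B \<beta>\<close> dvd_trans
      by (simp add: subst3_subst3 k subst3_scale[OF G] eval3_const3_xyz) blast
    then show "B' dvd G" using ndk prime' prime_elem_dvd_multD prime_elem_dvd_power by blast
  qed
  then show ?thesis using curve B'(2) by blast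
qed

lemma not_dvd_linear_form:
  assumes "homogeneous d B" "B \<noteq> 0" "d \<ge> 2" "homogeneous 1 L" "L \<noteq> 0"
  shows "\<not> B dvd L"
  using homogeneous_dvd[OF assms(4,5), of B] homogeneous_unique[OF assms(1)] assms(2,3) by fastforce

section \<open>Linear changes of coordinates and quadratic maps\<close>

definition lift :: "complex ^ 3 \<Rightarrow> poly3 ^ 3" where
  "lift v = (\<chi> i. const3 (v $ i))"

definition lift_mat :: "complex ^ 3 ^ 3 \<Rightarrow> poly3 ^ 3 ^ 3" where
  "lift_mat A = (\<chi> i j. const3 (A $ i $ j))"

lemma lift_mat_mult: "lift_mat (A ** A') = lift_mat A ** lift_mat A'"
  by (simp add: vec_eq_iff lift_mat_def matrix_matrix_mult_def unital_hom_simps[OF unital_hom_const3]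
     unital_hom_mult[OF unital_hom_const3])

lemma lift_mat_1: "lift_mat (mat 1) = mat 1"
  by (simp add: vec_eq_iff lift_mat_def mat_def unital_hom_1 unital_hom_0 unital_hom_const3)

lemma lift_mat_inverse: "A ** A' = mat 1 \<Longrightarrow> lift_mat A *v (lift_mat A' *v \<theta>) = \<theta>"
  by (simp add: matrix_vector_mul_assoc lift_mat_1 flip: lift_mat_mult)

lemma compose_map_lift: "compose_map (lift_mat A *v \<theta>) a = lift_mat A *v compose_map \<theta> a"
  by (simp add: vec_eq_iff compose_map_nth matrix_vector_mult_def subst3_simps lift_mat_def)

lemma compose_map_xyz: "compose_map xyz a = a"
  by (simp add: vec_eq_iff compose_map_nth subst3_simps)

lemma compose_map_scale: "compose_map (h *s \<theta>) a = eval3 const3 h a *s compose_map \<theta> a"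
  by (simp add: vec_eq_iff compose_map_nth subst3_simps)

lemma lift_mat_scale: "lift_mat A *v (h *s \<theta>) = h *s (lift_mat A *v \<theta>)"
  by (simp add: vec_eq_iff matrix_vector_mult_def sum_distrib_left mult_ac)

lemma homogeneous_lift_mat:
  assumes "\<And>i. homogeneous e (\<theta> $ i)" shows "homogeneous e ((lift_mat A *v \<theta>) $ i)"
proof -
  have "homogeneous (0 + e) (const3 c * \<theta> $ j)" for c j
    by (intro homogeneous_mult assms homogeneous_const3)
  then show ?thesis by (simp add: matrix_vector_mult_def lift_mat_def homogeneous_sum)
qed

definition power_product :: "nat \<Rightarrow> nat \<Rightarrow> nat \<Rightarrow> poly3 ^ 3 \<Rightarrow> poly3" where
  "power_product a b c \<theta> = \<theta> $ 1 ^ a * \<theta> $ 2 ^ b * \<theta> $ 3 ^ c"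

lemma homogeneous_power_product:
  assumes "\<And>i. homogeneous e (\<theta> $ i)"
  shows "homogeneous ((a + b + c) * e) (power_product a b c \<theta>)"
proof -
  have "homogeneous (a * e + b * e + c * e) (power_product a b c \<theta>)"
    unfolding power_product_def by (intro homogeneous_mult homogeneous_power assms)
  then show ?thesis by (simp add: algebra_simps)
qed

lemma subst3_power_product: "eval3 const3 (power_product a b c \<theta>) \<phi> = power_product a b c (compose_map \<theta> \<phi>)"
  by (simp add: power_product_def subst3_simps compose_map_nth)

lemma prime_not_dvd_power_product:
  assumes "prime_elem B" "\<And>i. \<not> B dvd \<theta> $ i"
  shows "\<not> B dvd power_product a b c \<theta>"
  using assms prime_elem_dvd_power[OF assms(1)] by (auto simp: power_product_def prime_elem_dvd_mult_iff)

text \<open>\<open>\<theta>\<close> is a quadratic involution by monomials, with base points in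
  the vertices of the coordinate triangle or infinitely near to them, and \<open>A\<close> moves
  these to the base points wanted. The maps used are \<open>\<beta> = A \<theta>\<close> and
  \<open>\<alpha> = \<theta> A\<^sup>-\<^sup>1\<close>. All their exceptional curves are lines,
  which a curve of degree at least two is not a component of. The total transform of
  \<open>B\<close> has degree \<open>2 d\<close>; taking away exceptional lines of total degree
  more than \<open>d\<close> leaves a curve of degree less than \<open>d\<close>.\<close>

lemma quadratic_reduction:
  assumes CB: "cremona_equivalent C B" and d: "curve_degree B \<ge> 2"
    and mono: "\<And>i. \<exists>a b c. a + b + c = 2 \<and> \<theta> $ i = power_product a b c xyz"
    and invol: "compose_map \<theta> \<theta> = power_product a b c xyz *s xyz"
    and A: "A ** A' = mat 1"
    and E: "power_product p q r xyz dvd eval3 const3 B (lift_mat A *v \<theta>)" "p + q + r > curve_degree B"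
  shows "\<exists>B'. cremona_equivalent C B' \<and> curve_degree B' < curve_degree B"
proof -
  have B: "irreducible_plane_curve B" using CB by (rule cremona_equivalentE)
  obtain d where dB: "d > 0" "homogeneous d B" "prime_elem B" "B \<noteq> 0" "curve_degree B = d"
    using B by (rule irreducible_plane_curveE)
  have A'A: "A' ** A = mat 1" using A matrix_left_right_inverse by blast
  define L where "L = lift_mat A' *v xyz"
  define \<alpha> where "\<alpha> = compose_map \<theta> L"
  define \<beta> where "\<beta> = lift_mat A *v \<theta>"
  have L1: "homogeneous 1 (L $ i)" for i unfolding L_def by (intro homogeneous_lift_mat homogeneous_xyz)
  have \<theta>2: "homogeneous 2 (\<theta> $ i)" for i
  proof -
    obtain a b c where "a + b + c = 2" "\<theta> $ i = power_product a b c xyz" using mono by blast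
    then show ?thesis using homogeneous_power_product[of 1 xyz a b c] homogeneous_xyz by simp
  qed
  have \<beta>2: "homogeneous 2 (\<beta> $ i)" for i unfolding \<beta>_def by (intro homogeneous_lift_mat \<theta>2)
  have fm: "form_map \<alpha>" "form_map \<beta>"
    using L1 \<theta>2 \<beta>2 form_map_compose unfolding form_map_def \<alpha>_def by blast+
  have Lnz: "L $ i \<noteq> 0" for i
  proof
    assume 0: "L $ i = 0"
    have "compose_map L (lift_mat A *v xyz) = xyz"
      by (simp add: L_def compose_map_lift compose_map_xyz lift_mat_inverse[OF A'A])
    then have "eval3 const3 (L $ i) (lift_mat A *v xyz) = xyz $ i" by (simp flip: compose_map_nth)
    then show False using 0 xyz_nonzero[of i] by (simp add: subst3_simps)
  qed
  have BL: "\<not> B dvd L $ i" for i using not_dvd_linear_form[OF dB(2,4) _ L1 Lnz] d dB(5) by simp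
  have B\<alpha>: "\<not> B dvd \<alpha> $ i" for i
    using mono[of i] prime_not_dvd_power_product[OF dB(3) BL]
    by (auto simp: \<alpha>_def compose_map_nth subst3_power_product compose_map_xyz)
  define h where "h = power_product a b c L"
  have \<beta>\<alpha>: "compose_map \<beta> \<alpha> = h *s xyz"
  proof -
    have "compose_map \<beta> \<alpha> = lift_mat A *v compose_map (compose_map \<theta> \<theta>) L"
      by (simp add: \<beta>_def \<alpha>_def compose_map_lift compose_map_assoc)
    also have "\<dots> = h *s (lift_mat A *v L)"
      by (simp add: invol compose_map_scale compose_map_xyz lift_mat_scale subst3_power_product h_def)
    finally show ?thesis by (simp add: L_def lift_mat_inverse[OF A])
  qed
  have \<alpha>\<beta>: "compose_map \<alpha> \<beta> = power_product a b c xyz *s xyz"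
    by (simp add: \<alpha>_def \<beta>_def L_def compose_map_assoc compose_map_lift compose_map_xyz
        lift_mat_inverse[OF A'A] invol)
  have hnz: "h \<noteq> 0" using Lnz by (simp add: h_def power_product_def)
  have knz: "power_product a b c xyz \<noteq> 0" using xyz_nonzero by (simp add: power_product_def)
  have inv: "mutually_inverse \<alpha> \<beta>"
    unfolding mutually_inverse_def using fm \<beta>\<alpha> \<alpha>\<beta> hnz knz by blast
  obtain R where R: "eval3 const3 B \<beta> = power_product p q r xyz * R"
    using E(1) unfolding \<beta>_def by (elim dvdE)
  have nd: "\<not> B dvd h" "\<not> B dvd eval3 const3 (power_product p q r xyz) \<alpha>"
    by (auto simp: h_def subst3_power_product compose_map_xyz prime_not_dvd_power_product dB(3) BL B\<alpha>)
  obtain B' where B': "irreducible_plane_curve B'" "B' dvd R" "pulls_back \<alpha> B B'"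
    using transformed_curve[OF B inv \<beta>\<alpha> hnz nd(1) R nd(2)] by blast
  have nz: "eval3 const3 B \<beta> \<noteq> 0"
    using form_nonzero_subst[OF mutually_inverse_sym[OF inv] dB(2,4)] .
  have hom: "homogeneous (d * 2) (power_product p q r xyz * R)"
    using homogeneous_subst3[OF dB(2) \<beta>2] by (simp add: R)
  have Rnz: "R \<noteq> 0" using nz R by auto
  obtain s where s: "homogeneous s R"
    using homogeneous_factor[of "d * 2" R "power_product p q r xyz"] hom nz R by (auto simp: mult.commute)
  have "p + q + r + s = d * 2"
    using homogeneous_unique[OF homogeneous_mult[OF homogeneous_power_product[OF homogeneous_xyz, of p q r] s] hom] nz R
    by simp
  moreover obtain e where "e \<le> s" "homogeneous e B'" using homogeneous_dvd[OF s Rnz B'(2)] by blast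
  moreover have "B' \<noteq> 0" using B'(1) by (rule irreducible_plane_curveE)
  ultimately have "curve_degree B' < curve_degree B" using E(2) dB(5) curve_degree_eq by simp
  then show ?thesis using cremona_equivalent_extend[OF CB B'(1) inv B'(3)] by blast
qed

lemma linear_form_irreducible:
  assumes "homogeneous 1 L" "L \<noteq> 0" shows "irreducible L"
proof (rule irreducibleI)
  show "\<not> is_unit L"
  proof
    assume "is_unit L"
    moreover have "(1::poly3) = const3 1" by (simp add: unital_hom_1[OF unital_hom_const3])
    ultimately obtain e where "e \<le> 0" "homogeneous e L"
      using homogeneous_dvd[of 0 "1::poly3" L] homogeneous_const3[of 1] by auto
    then show False using homogeneous_unique[OF assms(1) _ assms(2)] by fastforce
  qed
  fix P Q assume PQ: "L = P * Q"
  obtain a where a: "homogeneous a P" using homogeneous_factor[of 1 P Q] assms PQ by blast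
  obtain b where b: "homogeneous b Q"
    using homogeneous_factor[of 1 Q P] assms PQ by (auto simp: mult.commute)
  have "a + b = 1" using homogeneous_unique[OF homogeneous_mult[OF a b], of 1] assms PQ by simp
  then consider "a = 0" | "b = 0" by linarith
  then show "is_unit P \<or> is_unit Q"
    using homogeneous_0_unit a b assms(2) PQ by cases auto
qed (use assms in simp)

text \<open>The form \<open>B(x u + y v)\<close>, where \<open>u, v\<close> are the first two
  columns of \<open>A\<close>, is the restriction of \<open>B\<close> to the line through these
  points. It has degree \<open>d\<close> and does not vanish, since otherwise the line would be
  a component of \<open>B\<close>. This is the part of the theorem of Bezout that excludes
  collinear base points.\<close>

lemma curve_restricted_to_line:
  assumes B: "irreducible_plane_curve B" and d: "curve_degree B \<ge> 2" and A: "A ** A' = mat 1"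
    and D: "homogeneous k D" "D dvd eval3 const3 B (lift_mat A *v vector [xyz $ 1, xyz $ 2, 0])"
  shows "k \<le> curve_degree B"
proof -
  obtain d where dB: "d > 0" "homogeneous d B" "irreducible B" "B \<noteq> 0" "curve_degree B = d"
    using B by (rule irreducible_plane_curveE)
  let ?F = "eval3 const3 B (lift_mat A *v vector [xyz $ 1, xyz $ 2, 0])"
  have "?F \<noteq> 0"
  proof
    assume 0: "?F = 0"
    have A'A: "A' ** A = mat 1" using A matrix_left_right_inverse by blast
    define L where "L = (lift_mat A' *v xyz) $ 3"
    have L1: "homogeneous 1 L" unfolding L_def by (intro homogeneous_lift_mat homogeneous_xyz)
    have Lv: "value_at L v = (A' *v v) $ 3" for v
      by (simp add: L_def matrix_vector_mult_def value_at_simps lift_mat_def)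
    have L0: "L \<noteq> 0"
    proof
      assume "L = 0"
      then have "(A' *v (A *v axis 3 1)) $ 3 = 0" using Lv[of "A *v axis 3 1"] by (simp add: value_at_simps)
      then show False by (simp add: matrix_vector_mul_assoc A'A)
    qed
    have "L dvd B"
    proof (rule irreducible_dvd_if_vanishes[OF linear_form_irreducible[OF L1 L0]])
      fix v assume "value_at L v = 0"
      then have v3: "(A' *v v) $ 3 = 0" by (simp add: Lv)
      have "map_value (lift_mat A *v vector [xyz $ 1, xyz $ 2, 0]) (A' *v v) = A *v (A' *v v)"
        using v3 by (simp add: vec_eq_iff map_value_def matrix_vector_mult_def value_at_simps lift_mat_def sum_3)
      then have "map_value (lift_mat A *v vector [xyz $ 1, xyz $ 2, 0]) (A' *v v) = v"
        by (simp add: matrix_vector_mul_assoc A)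
      then have "value_at ?F (A' *v v) = value_at B v" by (simp add: value_at_subst)
      then show "value_at B v = 0" by (simp add: 0 value_at_simps)
    qed
    then obtain Q where Q: "B = L * Q" by (elim dvdE)
    have "\<not> is_unit L" using linear_form_irreducible[OF L1 L0] by (simp add: irreducible_def)
    then have "is_unit Q" using irreducibleD[OF dB(3) Q] by blast
    then have "B dvd L" using Q by (simp add: mult_unit_dvd_iff)
    then show False using not_dvd_linear_form[OF dB(2,4) _ L1 L0] d dB(5) by simp
  qed
  moreover have "homogeneous (d * 1) ?F"
  proof (rule homogeneous_subst3[OF dB(2)])
    have "homogeneous 1 (vector [xyz $ 1, xyz $ 2, 0::poly3] $ i)" for i :: 3
      using exhaust_3[of i] homogeneous_xyz by auto
    then show "homogeneous 1 ((lift_mat A *v vector [xyz $ 1, xyz $ 2, 0]) $ i)" for i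
      by (rule homogeneous_lift_mat)
  qed
  moreover have "D \<noteq> 0" using D(2) \<open>?F \<noteq> 0\<close> by auto
  ultimately obtain e where "e \<le> d" "homogeneous e D" using homogeneous_dvd D(2) by fastforce
  then show ?thesis using homogeneous_unique[OF D(1)] \<open>D \<noteq> 0\<close> dB(5) by auto
qed

definition with_columns :: "complex ^ 3 \<Rightarrow> complex ^ 3 \<Rightarrow> complex ^ 3 \<Rightarrow> complex ^ 3 ^ 3" where
  "with_columns u v w = transpose (vector [u, v, w])"

lemma lift_with_columns:
  "lift_mat (with_columns u v w) *v \<theta> = \<theta> $ 1 *s lift u + \<theta> $ 2 *s lift v + \<theta> $ 3 *s lift w"
  by (simp add: vec_eq_iff with_columns_def lift_mat_def lift_def transpose_def matrix_vector_mult_def sum_3 mult.commute)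

lemma with_columns_mult: "with_columns u v w *v x = x $ 1 *s u + x $ 2 *s v + x $ 3 *s w"
  by (simp add: vec_eq_iff with_columns_def transpose_def matrix_vector_mult_def sum_3 mult.commute)

definition independent2 :: "complex ^ 3 \<Rightarrow> complex ^ 3 \<Rightarrow> bool" where
  "independent2 u v \<longleftrightarrow> (\<forall>a b. a *s u + b *s v = 0 \<longrightarrow> a = 0 \<and> b = 0)"

lemma with_columns_invertible:
  assumes ind: "independent2 u v" and w: "\<not> (\<exists>a b. w = a *s u + b *s v)"
  shows "\<exists>A'. with_columns u v w ** A' = mat 1"
proof -
  have "x = 0" if x: "with_columns u v w *v x = 0" for x
  proof -
    have eq: "x $ 1 *s u + x $ 2 *s v + x $ 3 *s w = 0" using x by (simp add: with_columns_mult)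
    have x3: "x $ 3 = 0"
    proof (rule ccontr)
      assume n: "x $ 3 \<noteq> 0"
      have "w = (- x $ 1 / x $ 3) *s u + (- x $ 2 / x $ 3) *s v"
      proof (rule vec_eq_iff[THEN iffD2], rule allI)
        fix i
        have "x $ 1 * u $ i + x $ 2 * v $ i + x $ 3 * w $ i = 0"
          using arg_cong[OF eq, of "\<lambda>z. z $ i"] by simp
        then have "x $ 3 * w $ i = - x $ 1 * u $ i - x $ 2 * v $ i"
          by (simp add: algebra_simps eq_neg_iff_add_eq_0)
        then show "w $ i = ((- x $ 1 / x $ 3) *s u + (- x $ 2 / x $ 3) *s v) $ i"
          using n by (simp add: field_simps)
      qed
      then show False using w by blast
    qed
    then have "x $ 1 = 0 \<and> x $ 2 = 0" using eq ind by (simp add: independent2_def)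
    then show ?thesis using x3 exhaust_3 by (simp add: vec_eq_iff forall_3)
  qed
  then have "\<exists>A'. A' ** with_columns u v w = mat 1" using matrix_left_invertible_ker by blast
  then show ?thesis using matrix_left_right_inverse by blast
qed

text \<open>A dimension count.\<close>

lemma exists_outside_plane: "\<exists>w. \<not> (\<exists>a b. w = a *s u + b *s (v :: complex ^ 3))"
proof (rule ccontr)
  assume "\<not> ?thesis"
  then have all: "\<exists>a b. w = a *s u + b *s v" for w by blast
  have "w \<in> vec.span {u, v}" for w
  proof -
    obtain a b where w: "w = a *s u + b *s v" using all by blast
    show ?thesis unfolding w by (intro vec.span_add vec.span_scale vec.span_base) simp_all
  qed
  then have "UNIV \<subseteq> vec.span {u, v}" by blast
  then have "vec.dim (UNIV :: (complex ^ 3) set) \<le> card {u, v}"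
    by (rule vec.span_card_ge_dim[rotated]) auto
  moreover have "card {u, v} \<le> 2" by (cases "u = v") auto
  ultimately show False unfolding vec_dim_card by simp
qed

section \<open>Germs of plane curves\<close>

definition coeff2 :: "poly2 \<Rightarrow> nat \<Rightarrow> nat \<Rightarrow> complex" where
  "coeff2 f j k = coeff (coeff f j) k"

definition mono2 :: "complex \<Rightarrow> nat \<Rightarrow> nat \<Rightarrow> poly2" where
  "mono2 c j k = monom (monom c k) j"

lemma mono2_eq: "const2 c * var_u ^ j * var_w ^ k = mono2 c j k"
proof -
  have 1: "const2 c = monom (monom c 0) 0" by (simp add: const2_def monom_0)
  have 2: "var_u = monom 1 1" "var_w = monom (monom 1 1) 0"
    by (simp_all add: var_u_def var_w_def monom_altdef)
  show ?thesis unfolding 1 2 by (simp add: monom_power mult_monom mono2_def)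
qed

lemma coeff2_mono2: "coeff2 (mono2 c j k) j' k' = (if j = j' \<and> k = k' then c else 0)"
  by (simp add: coeff2_def mono2_def)

lemma coeff2_sum: "coeff2 (sum f A) j k = (\<Sum>x\<in>A. coeff2 (f x) j k)"
  by (simp add: coeff2_def coeff_sum)

lemma coeff2_0 [simp]: "coeff2 0 j k = 0"
  by (simp add: coeff2_def)

lemma poly2_nonzero: "f \<noteq> 0 \<longleftrightarrow> (\<exists>j k. coeff2 f j k \<noteq> 0)"
  by (auto simp: coeff2_def poly_eq_iff)

lemma unital_hom_eval2: "unital_hom (\<lambda>f. eval2 f a b)"
  unfolding eval2_conv_hom_poly by (intro unital_hom_hom_poly unital_hom_const2)

lemma eval2_const2: "eval2 (const2 c) a b = const2 c"
  by (subst (1) const2_def)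
     (simp add: eval2_conv_hom_poly hom_poly_const unital_hom_hom_poly unital_hom_const2)

lemma eval2_var: "eval2 var_u a b = a" "eval2 var_w a b = b"
  by (simp_all add: eval2_conv_hom_poly hom_poly_const hom_poly_X unital_hom_hom_poly
      unital_hom_const2 var_u_def var_w_def)

lemmas eval2_simps = unital_hom_mult[OF unital_hom_eval2] unital_hom_add[OF unital_hom_eval2]
  unital_hom_1[OF unital_hom_eval2] unital_hom_simps[OF unital_hom_eval2] eval2_const2 eval2_var

lemma unital_hom_poly2_eqI:
  fixes f g :: "poly2 \<Rightarrow> 'r::comm_ring_1"
  assumes f: "unital_hom f" and g: "unital_hom g"
    and c: "\<And>c. f (const2 c) = g (const2 c)" and X: "f var_u = g var_u" "f var_w = g var_w"
  shows "f p = g p"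
proof -
  have f1: "unital_hom (\<lambda>q. f [:q:])" and g1: "unital_hom (\<lambda>q. g [:q:])"
    using unital_hom_comp[OF f unital_hom_const_poly] unital_hom_comp[OF g unital_hom_const_poly]
    by simp_all
  have 1: "f [:q:] = g [:q:]" for q
    by (rule unital_hom_poly_eqI[OF f1 g1]) (use c X in \<open>simp_all add: const2_def var_w_def\<close>)
  show "f p = g p"
    by (rule unital_hom_poly_eqI[OF f g]) (use 1 X in \<open>simp_all add: var_u_def\<close>)
qed

lemma eval2_eval2: "eval2 (eval2 f a b) a' b' = eval2 f (eval2 a a' b') (eval2 b a' b')"
  by (rule unital_hom_poly2_eqI[of "\<lambda>f. eval2 (eval2 f a b) a' b'"])
     (simp_all add: unital_hom_comp[OF unital_hom_eval2 unital_hom_eval2] unital_hom_eval2 eval2_simps)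

lemma eval2_ident: "eval2 f var_u var_w = f"
  by (rule unital_hom_poly2_eqI[of "\<lambda>f. eval2 f var_u var_w"])
     (simp_all add: unital_hom_eval2 unital_hom_ident eval2_simps)

lemma eval2_eval3: "eval2 (eval3 const2 F a) b c = eval3 const2 F (\<chi> i. eval2 (a $ i) b c)"
  by (simp add: unital_hom_eval3_comp[OF unital_hom_eval2 unital_hom_const2] eval2_const2)

lemma poly2_expand:
  "f = (\<Sum>j\<le>degree f. \<Sum>k\<le>degree (coeff f j). mono2 (coeff2 f j k) j k)"
  using eval2_ident[of f] by (simp add: eval2_def mono2_eq coeff2_def)

subsection \<open>Order at the origin\<close>

definition order_ge :: "nat \<Rightarrow> poly2 \<Rightarrow> bool" where
  "order_ge m f \<longleftrightarrow> (\<forall>j k. coeff2 f j k \<noteq> 0 \<longrightarrow> m \<le> j + k)"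

lemma order_ge_sum: "(\<And>x. x \<in> A \<Longrightarrow> order_ge m (f x)) \<Longrightarrow> order_ge m (sum f A)"
  unfolding order_ge_def coeff2_sum by (meson sum.not_neutral_contains_not_neutral)

lemma order_ge_mono: "order_ge n f \<Longrightarrow> m \<le> n \<Longrightarrow> order_ge m f"
  unfolding order_ge_def by (meson le_trans)

lemma order_ge_mult:
  assumes "order_ge m f" "order_ge n g" shows "order_ge (m + n) (f * g)"
  unfolding order_ge_def
proof (intro allI impI)
  fix j k assume "coeff2 (f * g) j k \<noteq> 0"
  then have "(\<Sum>a\<le>j. \<Sum>b\<le>k. coeff2 f a b * coeff2 g (j - a) (k - b)) \<noteq> 0"
    by (simp add: coeff2_def coeff_mult coeff_sum)
  then obtain a where a: "a \<in> {..j}" "(\<Sum>b\<le>k. coeff2 f a b * coeff2 g (j - a) (k - b)) \<noteq> 0"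
    by (rule sum.not_neutral_contains_not_neutral)
  from a(2) obtain b where b: "b \<in> {..k}" "coeff2 f a b * coeff2 g (j - a) (k - b) \<noteq> 0"
    by (rule sum.not_neutral_contains_not_neutral)
  then have "coeff2 f a b \<noteq> 0" "coeff2 g (j - a) (k - b) \<noteq> 0" by auto
  then have "m \<le> a + b" "n \<le> (j - a) + (k - b)" using assms unfolding order_ge_def by blast+
  then show "m + n \<le> j + k" using a(1) b(1) by simp
qed

lemma order_ge_0 [simp]: "order_ge 0 f"
  by (simp add: order_ge_def)

lemma order_ge_power: "order_ge m f \<Longrightarrow> order_ge (n * m) (f ^ n)"
  by (induction n) (simp_all add: order_ge_mult)

lemma order_ge_eval2:
  assumes f: "order_ge m f" and a: "order_ge 1 a" and b: "order_ge 1 b"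
  shows "order_ge m (eval2 f a b)"
  unfolding eval2_def
proof (intro order_ge_sum)
  fix j k
  show "order_ge m (const2 (coeff (coeff f j) k) * a ^ j * b ^ k)"
  proof (cases "coeff2 f j k = 0")
    case True
    then show ?thesis by (simp add: coeff2_def const2_def order_ge_def)
  next
    case False
    then have "m \<le> j + k" using f by (simp add: order_ge_def)
    moreover have "order_ge (0 + j * 1 + k * 1) (const2 (coeff (coeff f j) k) * a ^ j * b ^ k)"
      by (intro order_ge_mult order_ge_power a b order_ge_0)
    ultimately show ?thesis by (auto intro: order_ge_mono)
  qed
qed

lemma order_ge_shear: "order_ge 1 (var_w + const2 t * var_u)" "order_ge 1 var_u"
proof -
  have u: "var_u = mono2 1 1 0" and s: "var_w + const2 t * var_u = mono2 1 0 1 + mono2 t 1 0"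
    by (simp_all flip: mono2_eq add: unital_hom_1[OF unital_hom_const2])
  show "order_ge 1 (var_w + const2 t * var_u)"
    unfolding s by (auto simp: order_ge_def coeff2_def mono2_def split: if_splits)
  show "order_ge 1 var_u"
    unfolding u by (auto simp: order_ge_def coeff2_mono2 split: if_splits)
qed

lemma mult_origin_le: "coeff2 f j k \<noteq> 0 \<Longrightarrow> mult_origin f \<le> j + k"
  unfolding mult_origin_def coeff2_def by (rule Least_le) blast

lemma mult_origin_attained:
  assumes "f \<noteq> 0" shows "\<exists>j k. j + k = mult_origin f \<and> coeff2 f j k \<noteq> 0"
proof -
  have "\<exists>m. \<exists>j k. j + k = m \<and> coeff (coeff f j) k \<noteq> 0" using assms by (auto simp: poly2_nonzero coeff2_def)
  then show ?thesis unfolding mult_origin_def coeff2_def by (rule LeastI_ex)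
qed

lemma order_ge_mult_origin: "order_ge (mult_origin f) f"
  by (simp add: order_ge_def mult_origin_le)

subsection \<open>Strict transforms\<close>

text \<open>The monomial \<open>u\<^sup>j w\<^sup>k\<close> becomes
  \<open>u\<^sup>j\<^sup>+\<^sup>k w\<^sup>k\<close>; different monomials stay different, so
  there is no cancellation.\<close>

lemma coeff2_blowup_slope:
  "coeff2 (eval2 g var_u (var_u * var_w)) l k = (if k \<le> l then coeff2 g (l - k) k else 0)"
proof -
  have m: "const2 c * var_u ^ j * (var_u * var_w) ^ k = mono2 c (j + k) k" for c j k
    by (simp add: power_mult_distrib power_add mult_ac flip: mono2_eq)
  have "coeff2 (eval2 g var_u (var_u * var_w)) l k =
      (\<Sum>j\<le>degree g. \<Sum>k'\<le>degree (coeff g j). coeff2 (mono2 (coeff2 g j k') (j + k') k') l k)"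
    by (simp add: eval2_def m coeff2_sum coeff2_def[of g])
  also have "\<dots> = (\<Sum>j\<le>degree g. \<Sum>k'\<le>degree (coeff g j).
      if k \<le> l then coeff2 (mono2 (coeff2 g j k') j k') (l - k) k else 0)"
    by (intro sum.cong) (auto simp: coeff2_mono2)
  also have "\<dots> = (if k \<le> l then coeff2 g (l - k) k else 0)"
    by (subst (5) poly2_expand) (simp add: coeff2_sum)
  finally show ?thesis .
qed

lemma coeff2_blowup_vertical:
  "coeff2 (eval2 g (var_u * var_w) var_w) j l = (if j \<le> l then coeff2 g j (l - j) else 0)"
proof -
  have m: "const2 c * (var_u * var_w) ^ j * var_w ^ k = mono2 c j (j + k)" for c j k
    by (simp add: power_mult_distrib power_add mult_ac flip: mono2_eq)
  have "coeff2 (eval2 g (var_u * var_w) var_w) j l =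
      (\<Sum>j'\<le>degree g. \<Sum>k'\<le>degree (coeff g j'). coeff2 (mono2 (coeff2 g j' k') j' (j' + k')) j l)"
    by (simp add: eval2_def m coeff2_sum coeff2_def[of g])
  also have "\<dots> = (\<Sum>j'\<le>degree g. \<Sum>k'\<le>degree (coeff g j').
      if j \<le> l then coeff2 (mono2 (coeff2 g j' k') j' k') j (l - j) else 0)"
    by (intro sum.cong) (auto simp: coeff2_mono2)
  also have "\<dots> = (if j \<le> l then coeff2 g j (l - j) else 0)"
    by (subst (5) poly2_expand) (simp add: coeff2_sum)
  finally show ?thesis .
qed

lemma coeff2_div_var_u:
  assumes "\<And>l k. coeff2 P l k \<noteq> 0 \<Longrightarrow> m \<le> l"
  shows "coeff2 (P div var_u ^ m) l k = coeff2 P (l + m) k"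
proof -
  have v: "var_u ^ m = monom 1 m" by (simp add: var_u_def monom_altdef)
  have "coeff P l = 0" if "l < m" for l
    using assms[of l] that by (auto simp: poly_eq_iff coeff2_def)
  then have "monom 1 m dvd P" by (simp add: monom_1_dvd_iff')
  then obtain Q where Q: "P = monom 1 m * Q" by (elim dvdE)
  then have "P div var_u ^ m = Q" by (simp add: v)
  then show ?thesis by (simp add: Q coeff2_def coeff_monom_mult)
qed

lemma coeff2_div_var_w:
  assumes "\<And>j l. coeff2 P j l \<noteq> 0 \<Longrightarrow> m \<le> l"
  shows "coeff2 (P div var_w ^ m) j l = coeff2 P j (l + m)"
proof -
  have v: "var_w ^ m = [:monom 1 m:]" by (simp add: var_w_def monom_altdef poly_const_pow)
  have "coeff (coeff P j) l = 0" if "l < m" for j l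
    using assms[of j l] that by (auto simp: coeff2_def)
  then have "monom 1 m dvd coeff P j" for j by (simp add: monom_1_dvd_iff')
  then have "[:monom 1 m:] dvd P" by (simp add: const_poly_dvd_iff)
  then obtain Q where Q: "P = [:monom 1 m:] * Q" by (elim dvdE)
  have "[:monom 1 m:] * Q div [:monom 1 m:] = Q"
    by (rule nonzero_mult_div_cancel_left) simp
  then have "P div var_w ^ m = Q" by (simp only: v Q)
  then show ?thesis by (simp add: Q coeff2_def coeff_monom_mult)
qed

text \<open>The shear \<open>w \<mapsto> w + t u\<close> moves the direction of slope
  \<open>t\<close> to slope zero, where the blow-up acts monomial by monomial.\<close>

lemma coeff2_strict_transform_slope:
  defines "g f t \<equiv> eval2 f var_u (var_w + const2 t * var_u)"
  shows "coeff2 (strict_transform (Slope t) f) l k =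
    (if k \<le> l + mult_origin f then coeff2 (g f t) (l + mult_origin f - k) k else 0)"
proof -
  have eq: "eval2 f var_u (var_u * (var_w + const2 t)) = eval2 (g f t) var_u (var_u * var_w)"
    by (simp add: g_def eval2_eval2 eval2_simps algebra_simps)
  have "order_ge (mult_origin f) (g f t)"
    unfolding g_def by (intro order_ge_eval2 order_ge_mult_origin order_ge_shear)
  then have low: "mult_origin f \<le> l" if "coeff2 (eval2 (g f t) var_u (var_u * var_w)) l k \<noteq> 0" for l k
    using that by (auto simp: coeff2_blowup_slope order_ge_def split: if_splits) force
  have "coeff2 (eval2 (g f t) var_u (var_u * var_w) div var_u ^ mult_origin f) l k =
      coeff2 (eval2 (g f t) var_u (var_u * var_w)) (l + mult_origin f) k"
    by (rule coeff2_div_var_u, rule low)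
  then show ?thesis by (simp add: eq coeff2_blowup_slope)
qed

lemma coeff2_strict_transform_vertical:
  "coeff2 (strict_transform Vertical f) j l =
    (if j \<le> l + mult_origin f then coeff2 f j (l + mult_origin f - j) else 0)"
proof -
  have low: "mult_origin f \<le> l" if "coeff2 (eval2 f (var_u * var_w) var_w) j l \<noteq> 0" for j l
    using that order_ge_mult_origin[of f]
    by (auto simp: coeff2_blowup_vertical order_ge_def split: if_splits) force
  have "coeff2 (eval2 f (var_u * var_w) var_w div var_w ^ mult_origin f) j l =
      coeff2 (eval2 f (var_u * var_w) var_w) j (l + mult_origin f)"
    by (rule coeff2_div_var_w, rule low)
  then show ?thesis by (simp add: coeff2_blowup_vertical)
qed

text \<open>A shear is invertible and neither it nor its inverse lowers the order at the origin,
  so the order is unchanged.\<close>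

lemma shear_attained:
  assumes f: "f \<noteq> 0"
  shows "\<exists>j k. j + k = mult_origin f \<and> coeff2 (eval2 f var_u (var_w + const2 t * var_u)) j k \<noteq> 0"
proof (rule ccontr)
  let ?g = "eval2 f var_u (var_w + const2 t * var_u)" and ?m = "mult_origin f"
  assume none: "\<not> ?thesis"
  have "order_ge ?m ?g" by (intro order_ge_eval2 order_ge_mult_origin order_ge_shear)
  then have "order_ge (Suc ?m) ?g" using none by (metis order_ge_def not_less_eq_eq le_antisym)
  then have unsheared: "order_ge (Suc ?m) (eval2 ?g var_u (var_w + const2 (- t) * var_u))"
    by (rule order_ge_eval2) (rule order_ge_shear)+
  have "eval2 ?g var_u (var_w + const2 (- t) * var_u) = f"
    by (simp add: eval2_eval2 eval2_simps unital_hom_minus[OF unital_hom_const2] eval2_ident)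
  with unsheared have "order_ge (Suc ?m) f" by (simp only:)
  then show False using mult_origin_attained[OF f] by (metis order_ge_def Suc_n_not_le_n)
qed

text \<open>A monomial of least degree \<open>m = j + k\<close> of the (sheared) germ becomes,
  after division by the \<open>m\<close>-th power of the exceptional equation, a monomial in one
  variable of exponent \<open>k\<close> or \<open>j\<close>, which is at most \<open>m\<close>.\<close>

lemma strict_transform_multiplicity:
  assumes f: "f \<noteq> 0"
  shows "strict_transform a f \<noteq> 0 \<and> mult_origin (strict_transform a f) \<le> mult_origin f"
proof -
  have "\<exists>j k. j + k \<le> mult_origin f \<and> coeff2 (strict_transform a f) j k \<noteq> 0"
  proof (cases a)
    case (Slope t)
    obtain j k where jk: "j + k = mult_origin f"
        "coeff2 (eval2 f var_u (var_w + const2 t * var_u)) j k \<noteq> 0"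
      using shear_attained[OF f] by blast
    then have "coeff2 (strict_transform a f) 0 k \<noteq> 0"
      unfolding Slope coeff2_strict_transform_slope by (auto simp flip: jk(1))
    then show ?thesis using jk(1) by (intro exI[of _ 0] exI[of _ k]) simp
  next
    case Vertical
    obtain j k where jk: "j + k = mult_origin f" "coeff2 f j k \<noteq> 0"
      using mult_origin_attained[OF f] by blast
    then have "coeff2 (strict_transform a f) j 0 \<noteq> 0"
      unfolding Vertical coeff2_strict_transform_vertical by (auto simp flip: jk(1))
    then show ?thesis using jk(1) by (intro exI[of _ j] exI[of _ 0]) simp
  qed
  then show ?thesis using mult_origin_le poly2_nonzero le_trans by metis
qed

text \<open>After the shear, \<open>u\<^sup>j w\<^sup>k\<close> contributes
  \<open>u\<^sup>j\<^sup>+\<^sup>k\<^sup>-\<^sup>m w\<^sup>k\<close> to the strict transform.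
  Hence the two multiplicities together bound the weighted degree in which \<open>w\<close>
  counts twice.\<close>

lemma strict_transform_slope_weight:
  assumes "coeff2 (eval2 f var_u (var_w + const2 t * var_u)) j k \<noteq> 0"
  shows "mult_origin f + mult_origin (strict_transform (Slope t) f) \<le> j + 2 * k"
proof -
  have "order_ge (mult_origin f) (eval2 f var_u (var_w + const2 t * var_u))"
    by (intro order_ge_eval2 order_ge_mult_origin order_ge_shear)
  then have m: "mult_origin f \<le> j + k" using assms by (simp add: order_ge_def)
  then have "coeff2 (strict_transform (Slope t) f) (j + k - mult_origin f) k \<noteq> 0"
    using assms unfolding coeff2_strict_transform_slope by simp
  from mult_origin_le[OF this] show ?thesis using m by simp
qed

lemma strict_transform_vertical_weight:
  assumes "coeff2 f j k \<noteq> 0"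
  shows "mult_origin f + mult_origin (strict_transform Vertical f) \<le> 2 * j + k"
proof -
  have m: "mult_origin f \<le> j + k" using assms by (rule mult_origin_le)
  then have "coeff2 (strict_transform Vertical f) j (j + k - mult_origin f) \<noteq> 0"
    using assms unfolding coeff2_strict_transform_vertical by simp
  from mult_origin_le[OF this] show ?thesis using m by simp
qed

section \<open>Local equations as dehomogenized forms\<close>

definition normalized :: "complex ^ 3 \<Rightarrow> bool" where
  "normalized v \<longleftrightarrow> v $ 1 = 1 \<or> (v $ 1 = 0 \<and> v $ 2 = 1) \<or> (v $ 1 = 0 \<and> v $ 2 = 0 \<and> v $ 3 = 1)"

lemma normalized_nonzero: "normalized v \<Longrightarrow> v \<noteq> 0"
  by (auto simp: normalized_def)

lemma normal_coords: "proj (normal_coords p) = p \<and> normalized (normal_coords p)"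
proof -
  have "\<exists>!v. proj v = p \<and> normalized v"
  proof (rule ex_ex1I)
    obtain v where v: "v \<noteq> 0" "p = proj v" by (rule proj_surj)
    have scaled: "\<exists>v. proj v = p \<and> normalized v" if "normalized (c *s v)" for c
      using that v proj_eq_iff[OF v(1) normalized_nonzero[OF that]] by metis
    consider "v $ 1 \<noteq> 0" | "v $ 1 = 0" "v $ 2 \<noteq> 0" | "v $ 1 = 0" "v $ 2 = 0" "v $ 3 \<noteq> 0"
      using v(1) by (auto simp: vec_eq_iff forall_3)
    then show "\<exists>v. proj v = p \<and> normalized v"
    proof cases
      case 1 then show ?thesis by (intro scaled[of "inverse (v $ 1)"]) (simp add: normalized_def)
    next
      case 2 then show ?thesis by (intro scaled[of "inverse (v $ 2)"]) (simp add: normalized_def)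
    next
      case 3 then show ?thesis by (intro scaled[of "inverse (v $ 3)"]) (simp add: normalized_def)
    qed
  next
    fix v w assume v: "proj v = p \<and> normalized v" and w: "proj w = p \<and> normalized w"
    then obtain c where c: "w = c *s v"
      using proj_eq_iff[of v w] normalized_nonzero by auto
    have "c = 1" using v w unfolding c by (auto simp: normalized_def)
    then show "v = w" using c by simp
  qed
  from theI'[OF this] show ?thesis unfolding normal_coords_def normalized_def .
qed

text \<open>Intended for vectors \<open>n\<close> with \<open>r\<close>-th entry one;
  \<open>a\<close> and \<open>b\<close> are the affine coordinates belonging to \<open>s\<close>
  and to the third index, centred at \<open>n\<close>. The three cases in the definition of
  local equations are the values of \<open>r\<close>.\<close>

definition chart_point :: "complex ^ 3 \<Rightarrow> 3 \<Rightarrow> 3 \<Rightarrow> poly2 \<Rightarrow> poly2 \<Rightarrow> poly2 ^ 3" where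
  "chart_point n r s a b = (\<chi> i. if i = r then 1 else if i = s then const2 (n $ i) + a else const2 (n $ i) + b)"

lemma local_equation_chart:
  obtains n r s t where "proj n = p" "n $ r = 1" "r \<noteq> s" "r \<noteq> t" "s \<noteq> (t::3)"
    "\<forall>F. local_equation F p = eval3 const2 F (chart_point n r s var_u var_w)"
proof -
  define n where "n = normal_coords p"
  have n: "proj n = p" "normalized n" using normal_coords by (simp_all add: n_def)
  have 0: "const2 0 = 0" by (simp add: const2_def)
  consider "n $ 1 = 1" | "n $ 1 = 0" "n $ 2 = 1" | "n $ 1 = 0" "n $ 2 = 0" "n $ 3 = 1"
    using n(2) by (auto simp: normalized_def)
  then show ?thesis
  proof cases
    case 1
    then have "local_equation F p = eval3 const2 F (chart_point n 1 2 var_u var_w)" for F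
      by (simp add: local_equation_def n_def[symmetric] Let_def)
         (rule arg_cong[of _ _ "eval3 const2 F"], simp add: chart_point_def vec_eq_iff forall_3)
    then show ?thesis using that[of n 1 2 3] n(1) 1 by simp
  next
    case 2
    then have "local_equation F p = eval3 const2 F (chart_point n 2 1 var_u var_w)" for F
      by (simp add: local_equation_def n_def[symmetric] Let_def)
         (rule arg_cong[of _ _ "eval3 const2 F"], simp add: chart_point_def vec_eq_iff forall_3 0)
    then show ?thesis using that[of n 2 1 3] n(1) 2 by simp
  next
    case 3
    then have "local_equation F p = eval3 const2 F (chart_point n 3 1 var_u var_w)" for F
      by (simp add: local_equation_def n_def[symmetric] Let_def)
         (rule arg_cong[of _ _ "eval3 const2 F"], simp add: chart_point_def vec_eq_iff forall_3 0)
    then show ?thesis using that[of n 3 1 2] n(1) 3 by simp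
  qed
qed

text \<open>The form \<open>F\<close> in linear coordinates adapted to the point
  \<open>n\<close> and to the direction of slope \<open>c\<close>: its dehomogenization is the
  local equation at \<open>n\<close>, sheared by \<open>c\<close>.\<close>

definition chart_form :: "complex ^ 3 \<Rightarrow> 3 \<Rightarrow> 3 \<Rightarrow> complex \<Rightarrow> poly3 \<Rightarrow> poly3" where
  "chart_form n r s c F = eval3 const3 F (\<chi> i. if i = r then xyz $ 1
     else if i = s then const3 (n $ i) * xyz $ 1 + xyz $ 2
     else const3 (n $ i) * xyz $ 1 + const3 c * xyz $ 2 + xyz $ 3)"

lemma eval2_chart:
  assumes "r \<noteq> s"
  shows "eval2 (eval3 const2 F (chart_point n r s var_u var_w)) var_u (var_w + const2 c * var_u) =
    eval3 const2 (chart_form n r s c F) (vector [1, var_u, var_w])"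
  unfolding eval2_eval3 chart_form_def eval3_subst3[OF unital_hom_const2]
  by (rule arg_cong[of _ _ "eval3 const2 F"])
     (simp add: vec_eq_iff chart_point_def eval2_simps unital_hom_const2
       unital_hom_mult[OF unital_hom_eval3] unital_hom_add[OF unital_hom_eval3] eval3_xyz eval3_const3)

text \<open>The coordinate change in \<^const>\<open>chart_form\<close> is undone; the last two
  arguments are the local coordinates of \<open>\<theta>\<close>, made homogeneous.\<close>

lemma form_from_chart:
  assumes "n $ r = 1" "r \<noteq> s" "r \<noteq> t" "s \<noteq> t"
  shows "eval3 const3 F \<theta> = eval3 const3 (chart_form n r s c F)
    (vector [\<theta> $ r, \<theta> $ s - const3 (n $ s) * \<theta> $ r,
       \<theta> $ t - const3 (n $ t) * \<theta> $ r - const3 c * (\<theta> $ s - const3 (n $ s) * \<theta> $ r)])"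
proof -
  have t: "i = t" if "i \<noteq> r" "i \<noteq> s" for i
    using assms that exhaust_3[of i] exhaust_3[of r] exhaust_3[of s] exhaust_3[of t] by auto
  show ?thesis
    unfolding chart_form_def eval3_subst3[OF unital_hom_const3]
    by (rule arg_cong[of _ _ "eval3 const3 F"])
       (use assms t in \<open>auto simp: vec_eq_iff subst3_simps algebra_simps\<close>)
qed

lemma homogeneous_chart_form:
  assumes "homogeneous d F" shows "homogeneous d (chart_form n r s c F)"
proof -
  have l: "homogeneous 1 (const3 a * xyz $ i)" for a i
    using homogeneous_mult[OF homogeneous_const3 homogeneous_xyz] by simp
  have "homogeneous (d * 1) (chart_form n r s c F)"
    unfolding chart_form_def
  proof (rule homogeneous_subst3[OF assms])
    fix i
    show "homogeneous 1 ((\<chi> i. if i = r then xyz $ 1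
     else if i = s then const3 (n $ i) * xyz $ 1 + xyz $ 2
     else const3 (n $ i) * xyz $ 1 + const3 c * xyz $ 2 + xyz $ 3) $ i)"
      by (simp only: vec_lambda_beta split: if_split)
         (intro conjI impI homogeneous_add l homogeneous_xyz)
  qed
  then show ?thesis by simp
qed

text \<open>Setting \<open>x = 1\<close> in a form loses nothing, because the exponent of
  \<open>x\<close> is determined by the other two.\<close>

lemma coeff2_dehomogenize:
  assumes G: "homogeneous d G" and nz: "coeff3 G i j k \<noteq> 0"
  shows "coeff2 (eval3 const2 G (vector [1, var_u, var_w])) j k = coeff3 G i j k"
proof -
  have i: "i + j + k = d" using assms by (simp add: homogeneous_def)
  have "coeff2 (eval3 const2 G (vector [1, var_u, var_w])) j k =
    (\<Sum>i'\<le>degree G. \<Sum>j'\<le>degree (coeff G i'). \<Sum>k'\<le>degree (coeff (coeff G i') j').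
      coeff2 (mono2 (coeff3 G i' j' k') j' k') j k)"
    by (simp add: eval3_def coeff2_sum mono2_eq)
  also have "\<dots> = (\<Sum>i'\<le>degree G. \<Sum>j'\<le>degree (coeff G i'). \<Sum>k'\<le>degree (coeff (coeff G i') j').
      coeff3 (mono3 (coeff3 G i' j' k') i' j' k') i j k)"
  proof (intro sum.cong refl)
    fix i' j' k'
    show "coeff2 (mono2 (coeff3 G i' j' k') j' k') j k = coeff3 (mono3 (coeff3 G i' j' k') i' j' k') i j k"
    proof (cases "coeff3 G i' j' k' = 0")
      case False
      then have "i' + j' + k' = d" using G by (simp add: homogeneous_def)
      then show ?thesis using i by (auto simp: coeff2_mono2 coeff3_mono3)
    qed (simp add: coeff2_mono2 coeff3_mono3)
  qed
  also have "\<dots> = coeff3 G i j k"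
    by (subst (4) poly3_expand) (simp add: coeff3_sum)
  finally show ?thesis .
qed

lemma power_dvd_by_weights:
  assumes w: "\<And>i j k. coeff3 G i j k \<noteq> 0 \<Longrightarrow> M \<le> a * j + b * k"
    and P: "x ^ a dvd P" and Q: "x ^ b dvd Q"
  shows "x ^ M dvd eval3 const3 G (vector [\<rho>, P, Q])"
  unfolding eval3_def
proof (intro dvd_sum)
  fix i j k
  let ?v = "vector [\<rho>, P, Q] :: poly3 ^ 3"
  show "x ^ M dvd const3 (coeff3 G i j k) * ?v $ 1 ^ i * ?v $ 2 ^ j * ?v $ 3 ^ k"
  proof (cases "coeff3 G i j k = 0")
    case False
    have "(x ^ a) ^ j * (x ^ b) ^ k dvd P ^ j * Q ^ k"
      by (intro mult_dvd_mono dvd_power_same P Q)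
    moreover have "x ^ M dvd (x ^ a) ^ j * (x ^ b) ^ k"
      using w[OF False] by (simp add: le_imp_power_dvd flip: power_mult power_add)
    ultimately have "x ^ M dvd P ^ j * Q ^ k" by (rule dvd_trans[rotated])
    then show ?thesis by (simp add: mult.assoc dvd_mult)
  qed (simp add: const3_def)
qed

lemma local_equation_multiplicity_le_degree:
  assumes F: "homogeneous d F" "F \<noteq> 0"
  shows "local_equation F p \<noteq> 0 \<and> mult_origin (local_equation F p) \<le> d"
proof -
  obtain n r s t where c: "proj n = p" "n $ r = 1" "r \<noteq> s" "r \<noteq> t" "s \<noteq> (t::3)"
    and loc: "\<forall>F. local_equation F p = eval3 const2 F (chart_point n r s var_u var_w)"
    by (rule local_equation_chart[of p])
  define G where "G = chart_form n r s 0 F"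
  have "G \<noteq> 0"
  proof
    assume "G = 0"
    then have "eval3 const3 F xyz = 0"
      using form_from_chart[OF c(2-5), of F xyz 0] by (simp add: G_def subst3_simps)
    then show False using F(2) by (simp add: eval3_const3_xyz)
  qed
  then obtain i j k where nz: "coeff3 G i j k \<noteq> 0" using poly3_eqI[of G 0] by auto
  have hom: "homogeneous d G" unfolding G_def by (rule homogeneous_chart_form[OF F(1)])
  have "local_equation F p = eval3 const2 G (vector [1, var_u, var_w])"
    using eval2_chart[OF c(3), of F n 0] by (simp add: loc G_def const2_def eval2_ident)
  then have nz2: "coeff2 (local_equation F p) j k \<noteq> 0"
    using coeff2_dehomogenize[OF hom nz] nz by simp
  have "i + j + k = d" using hom nz unfolding homogeneous_def by blast
  then have "j + k \<le> d" by simp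
  then show ?thesis using nz2 mult_origin_le[OF nz2] poly2_nonzero by auto
qed

lemma germ_at_append: "germ_at F (p, ds @ es) = fold strict_transform es (germ_at F (p, ds))"
  by (simp add: germ_at_def)

lemma fold_strict_transform:
  "f \<noteq> 0 \<Longrightarrow> fold strict_transform ds f \<noteq> 0 \<and> mult_origin (fold strict_transform ds f) \<le> mult_origin f"
proof (induction ds arbitrary: f)
  case (Cons a ds)
  then show ?case using strict_transform_multiplicity[OF Cons.prems, of a]
    by (metis fold_simps(2) le_trans)
qed simp

lemma germ_at_nonzero:
  assumes "homogeneous d F" "F \<noteq> 0" shows "germ_at F q \<noteq> 0"
  using fold_strict_transform local_equation_multiplicity_le_degree[OF assms] by (simp add: germ_at_def)

lemma multiplicity_at_append_le:
  assumes "homogeneous d F" "F \<noteq> 0"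
  shows "multiplicity_at F (p, ds @ es) \<le> multiplicity_at F (p, ds)"
  using fold_strict_transform[OF germ_at_nonzero[OF assms]] by (simp add: multiplicity_at_def germ_at_append)

lemma multiplicity_at_le_degree:
  assumes "homogeneous d F" "F \<noteq> 0" shows "multiplicity_at F q \<le> d"
proof -
  have "multiplicity_at F (fst q, [] @ snd q) \<le> multiplicity_at F (fst q, [])"
    by (rule multiplicity_at_append_le[OF assms])
  also have "\<dots> \<le> d" using local_equation_multiplicity_le_degree[OF assms]
    by (simp add: multiplicity_at_def germ_at_def)
  finally show ?thesis by simp
qed

section \<open>Vanishing of a form at a proper or first-order infinitely near point\<close>

lemma lift_nth: "lift v $ i = const3 (v $ i)"
  by (simp add: lift_def)

text \<open>In the coordinates of the chart the argument is a multiple of \<open>(1, 0,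
  0)\<close> up to multiples of \<open>x\<close>, and every monomial of the form has degree at
  least the multiplicity in the last two coordinates. Taking \<open>x\<close> as an exceptional
  line of a quadratic map, this gives the multiplicity of that line in the total transform; with
  arguments on a line it gives an intersection number.\<close>

lemma proper_point_vanishing:
  assumes F: "homogeneous d F" and v: "v \<noteq> 0"
  shows "x ^ multiplicity_at F (proj v, []) dvd eval3 const3 F (\<rho> *s lift v + x *s \<eta>)"
proof -
  obtain n r s t where c: "proj n = proj v" "n $ r = 1" "r \<noteq> s" "r \<noteq> t" "s \<noteq> (t::3)"
    and loc: "\<forall>F. local_equation F (proj v) = eval3 const2 F (chart_point n r s var_u var_w)"
    by (rule local_equation_chart[of "proj v"])
  have "n \<noteq> 0" using c(2) by auto
  then obtain a where a: "v = a *s n" using proj_eq_iff[of n v] c(1) v by auto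
  define G where "G = chart_form n r s 0 F"
  have hom: "homogeneous d G" unfolding G_def by (rule homogeneous_chart_form[OF F(1)])
  have f: "local_equation F (proj v) = eval3 const2 G (vector [1, var_u, var_w])"
    using eval2_chart[OF c(3), of F n 0] by (simp add: loc G_def const2_def eval2_ident)
  have w: "multiplicity_at F (proj v, []) \<le> 1 * j + 1 * k" if "coeff3 G i j k \<noteq> 0" for i j k
    using mult_origin_le[of "local_equation F (proj v)" j k] coeff2_dehomogenize[OF hom that] that
    by (simp add: multiplicity_at_def germ_at_def f)
  have van: "x ^ 1 dvd (\<rho> *s lift v + x *s \<eta>) $ i - const3 (n $ i) * (\<rho> *s lift v + x *s \<eta>) $ r" for i
  proof -
    have "(\<rho> *s lift v + x *s \<eta>) $ i - const3 (n $ i) * (\<rho> *s lift v + x *s \<eta>) $ r =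
        x * (\<eta> $ i - const3 (n $ i) * \<eta> $ r)"
      using c(2) by (simp add: a lift_nth unital_hom_mult[OF unital_hom_const3]
          unital_hom_1[OF unital_hom_const3] algebra_simps)
    then show ?thesis by simp
  qed
  show ?thesis
    unfolding form_from_chart[OF c(2-5), of F _ 0] G_def[symmetric]
  proof (rule power_dvd_by_weights[OF w])
    let ?\<theta> = "\<rho> *s lift v + x *s \<eta>"
    show "x ^ 1 dvd ?\<theta> $ s - const3 (n $ s) * ?\<theta> $ r" by (rule van)
    show "x ^ 1 dvd ?\<theta> $ t - const3 (n $ t) * ?\<theta> $ r - const3 0 * (?\<theta> $ s - const3 (n $ s) * ?\<theta> $ r)"
      by (intro dvd_diff dvd_mult van)
  qed
qed

text \<open>In coordinates in which the direction of the infinitely near point is a coordinate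
  axis, one local coordinate of the argument is divisible by \<open>x\<close> and the other by
  \<open>x\<^sup>2\<close>. Therefore a monomial contributes its weighted degree, which is at
  least the sum of the two multiplicities.\<close>

lemma near_point_vanishing:
  assumes F: "homogeneous d F" and v: "v \<noteq> 0"
  shows "\<exists>\<delta>. independent2 v \<delta> \<and> (\<forall>x \<rho> \<kappa> \<eta>.
    x ^ (multiplicity_at F (proj v, []) + multiplicity_at F (proj v, [D])) dvd
      eval3 const3 F (\<rho> *s lift v + (x * \<kappa>) *s lift \<delta> + x\<^sup>2 *s \<eta>))"
proof -
  obtain n r s t where c: "proj n = proj v" "n $ r = 1" "r \<noteq> s" "r \<noteq> t" "s \<noteq> (t::3)"
    and loc: "\<forall>F. local_equation F (proj v) = eval3 const2 F (chart_point n r s var_u var_w)"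
    by (rule local_equation_chart[of "proj v"])
  have "n \<noteq> 0" using c(2) by auto
  then obtain a where a: "v = a *s n" using proj_eq_iff[of n v] c(1) v by auto
  have a0: "a \<noteq> 0" using v a by auto
  let ?f = "local_equation F (proj v)"
  let ?M = "multiplicity_at F (proj v, []) + multiplicity_at F (proj v, [D])"
  have M: "?M = mult_origin ?f + mult_origin (strict_transform D ?f)"
    by (simp add: multiplicity_at_def germ_at_def)
  have ind: "independent2 v \<delta>" if "\<delta> $ r = 0" "\<delta> \<noteq> 0" for \<delta>
    unfolding independent2_def
  proof (intro allI impI)
    fix b e assume eq: "b *s v + e *s \<delta> = 0"
    have "b = 0" using arg_cong[OF eq, of "\<lambda>z. z $ r"] that(1) a0 c(2) by (simp add: a)
    then show "b = 0 \<and> e = 0" using eq that(2) by simp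
  qed
  have diff: "(\<rho> *s lift v + (x * \<kappa>) *s lift \<delta> + x\<^sup>2 *s \<eta>) $ i -
        const3 (n $ i) * (\<rho> *s lift v + (x * \<kappa>) *s lift \<delta> + x\<^sup>2 *s \<eta>) $ r =
        x * \<kappa> * const3 (\<delta> $ i) + x\<^sup>2 * (\<eta> $ i - const3 (n $ i) * \<eta> $ r)"
    if "\<delta> $ r = 0" for \<delta> \<rho> x \<kappa> \<eta> i
    using c(2) that by (simp add: a lift_nth unital_hom_mult[OF unital_hom_const3]
          unital_hom_0[OF unital_hom_const3] unital_hom_1[OF unital_hom_const3] algebra_simps)
  show ?thesis
  proof (cases D)
    case (Slope b)
    define \<delta> :: "complex ^ 3" where "\<delta> = (\<chi> i. if i = s then 1 else if i = t then b else 0)"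
    have \<delta>: "\<delta> $ r = 0" "\<delta> $ s = 1" "\<delta> $ t = b" using c by (auto simp: \<delta>_def)
    define G where "G = chart_form n r s b F"
    have hom: "homogeneous d G" unfolding G_def by (rule homogeneous_chart_form[OF F(1)])
    have w: "?M \<le> 1 * j + 2 * k" if "coeff3 G i j k \<noteq> 0" for i j k
    proof -
      have "coeff2 (eval2 ?f var_u (var_w + const2 b * var_u)) j k \<noteq> 0"
        using coeff2_dehomogenize[OF hom that] that by (simp add: loc eval2_chart[OF c(3)] G_def)
      from strict_transform_slope_weight[OF this] show ?thesis unfolding M unfolding Slope by simp
    qed
    have "x ^ ?M dvd eval3 const3 F (\<rho> *s lift v + (x * \<kappa>) *s lift \<delta> + x\<^sup>2 *s \<eta>)" for x \<rho> \<kappa> \<eta>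
      unfolding form_from_chart[OF c(2-5), of F _ b] G_def[symmetric] diff[OF \<delta>(1)]
    proof (rule power_dvd_by_weights[OF w])
      show "x ^ 1 dvd x * \<kappa> * const3 (\<delta> $ s) + x\<^sup>2 * (\<eta> $ s - const3 (n $ s) * \<eta> $ r)"
        by (simp add: power2_eq_square dvd_add mult.assoc)
      have "x * \<kappa> * const3 (\<delta> $ t) + x\<^sup>2 * (\<eta> $ t - const3 (n $ t) * \<eta> $ r) -
          const3 b * (x * \<kappa> * const3 (\<delta> $ s) + x\<^sup>2 * (\<eta> $ s - const3 (n $ s) * \<eta> $ r)) =
          x\<^sup>2 * ((\<eta> $ t - const3 (n $ t) * \<eta> $ r) - const3 b * (\<eta> $ s - const3 (n $ s) * \<eta> $ r))"
        by (simp add: \<delta> unital_hom_1[OF unital_hom_const3] algebra_simps)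
      then show "x\<^sup>2 dvd x * \<kappa> * const3 (\<delta> $ t) + x\<^sup>2 * (\<eta> $ t - const3 (n $ t) * \<eta> $ r) -
          const3 b * (x * \<kappa> * const3 (\<delta> $ s) + x\<^sup>2 * (\<eta> $ s - const3 (n $ s) * \<eta> $ r))"
        by simp
    qed
    moreover have "\<delta> \<noteq> 0" using \<delta>(2) by auto
    ultimately show ?thesis using ind \<delta>(1) by blast
  next
    case Vertical
    define \<delta> :: "complex ^ 3" where "\<delta> = axis t 1"
    have \<delta>: "\<delta> $ r = 0" "\<delta> $ s = 0" "\<delta> $ t = 1" using c by (auto simp: \<delta>_def axis_def)
    define G where "G = chart_form n r s 0 F"
    have hom: "homogeneous d G" unfolding G_def by (rule homogeneous_chart_form[OF F(1)])
    have f: "?f = eval3 const2 G (vector [1, var_u, var_w])"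
      using eval2_chart[OF c(3), of F n 0] by (simp add: loc G_def const2_def eval2_ident)
    have w: "?M \<le> 2 * j + 1 * k" if "coeff3 G i j k \<noteq> 0" for i j k
    proof -
      have "coeff2 ?f j k \<noteq> 0" using coeff2_dehomogenize[OF hom that] that by (simp add: f)
      from strict_transform_vertical_weight[OF this] show ?thesis unfolding M unfolding Vertical by simp
    qed
    have "x ^ ?M dvd eval3 const3 F (\<rho> *s lift v + (x * \<kappa>) *s lift \<delta> + x\<^sup>2 *s \<eta>)" for x \<rho> \<kappa> \<eta>
      unfolding form_from_chart[OF c(2-5), of F _ 0] G_def[symmetric] diff[OF \<delta>(1)]
    proof (rule power_dvd_by_weights[OF w])
      show "x\<^sup>2 dvd x * \<kappa> * const3 (\<delta> $ s) + x\<^sup>2 * (\<eta> $ s - const3 (n $ s) * \<eta> $ r)"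
        by (simp add: \<delta> unital_hom_0[OF unital_hom_const3])
      show "x ^ 1 dvd x * \<kappa> * const3 (\<delta> $ t) + x\<^sup>2 * (\<eta> $ t - const3 (n $ t) * \<eta> $ r) -
          const3 0 * (x * \<kappa> * const3 (\<delta> $ s) + x\<^sup>2 * (\<eta> $ s - const3 (n $ s) * \<eta> $ r))"
        by (simp add: unital_hom_0[OF unital_hom_const3] power2_eq_square dvd_add mult.assoc)
    qed
    moreover have "\<delta> \<noteq> 0" using \<delta>(3) by auto
    ultimately show ?thesis using ind \<delta>(1) by blast
  qed
qed

section \<open>Quadratic maps that lower the degree\<close>

lemma xyz_prime: "prime_elem (xyz $ i)"
  using linear_form_irreducible[OF homogeneous_xyz xyz_nonzero] by (simp add: prime_elem_iff_irreducible)

lemma xyz_not_dvd: "i \<noteq> j \<Longrightarrow> \<not> xyz $ i dvd xyz $ j"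
  using dvd_imp_vanishes[of "xyz $ i" "xyz $ j" "axis j 1"] by (auto simp: value_at_simps axis_def)

lemma coprime_powers_dvd:
  fixes p q F :: poly3
  assumes "prime_elem p" "\<not> p dvd q" "p ^ m dvd F" "q ^ n dvd F"
  shows "p ^ m * q ^ n dvd F"
  using assms by (intro divides_mult) (simp_all add: prime_elem_imp_coprime)

lemma power_product_dvd:
  assumes "xyz $ 1 ^ a dvd F" "xyz $ 2 ^ b dvd F" "xyz $ 3 ^ c dvd F"
  shows "power_product a b c xyz dvd F"
proof -
  have cop: "coprime (xyz $ i) (xyz $ j)" if "i \<noteq> j" for i j
    using that by (intro prime_elem_imp_coprime xyz_prime xyz_not_dvd)
  show ?thesis unfolding power_product_def
    using assms cop by (intro divides_mult) (simp_all add: coprime_mult_left_iff)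
qed

lemma homogeneous_linear2: "homogeneous 1 (const3 a * xyz $ i + const3 b * xyz $ j)"
proof -
  have "homogeneous (0 + 1) (const3 a * xyz $ i + const3 b * xyz $ j)"
    by (intro homogeneous_add homogeneous_mult homogeneous_const3 homogeneous_xyz)
  then show ?thesis by simp
qed

lemma distinct_points_independent:
  assumes "v \<noteq> 0" "w \<noteq> 0" "proj v \<noteq> proj w" shows "independent2 v w"
  unfolding independent2_def
proof (intro allI impI)
  fix a b assume eq: "a *s v + b *s w = 0"
  have b: "b = 0"
  proof (rule ccontr)
    assume "b \<noteq> 0"
    have "w = (- a / b) *s v"
      unfolding vec_eq_iff
    proof
      fix i
      have "a * v $ i + b * w $ i = 0" using arg_cong[OF eq, of "\<lambda>z. z $ i"] by simp
      then have "b * w $ i = - a * v $ i" by (simp add: eq_neg_iff_add_eq_0 add.commute)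
      then show "w $ i = ((- a / b) *s v) $ i" using \<open>b \<noteq> 0\<close> by (simp add: field_simps)
    qed
    then show False using proj_eq_iff[OF assms(1,2)] assms(3) by blast
  qed
  then show "a = 0 \<and> b = 0" using eq assms(1) by simp
qed

text \<open>In the parametrization \<open>x u + y w\<close> of a line, the point \<open>a u + b
  w\<close> has the equation \<open>x - (a / b) y\<close>, and it is a zero of the restricted
  form of at least its multiplicity.\<close>

lemma line_third_point:
  assumes F: "homogeneous d F" and v: "v \<noteq> 0" "v = a *s u + b *s w" and b: "b \<noteq> 0"
  shows "(const3 1 * xyz $ 1 + const3 (- a / b) * xyz $ 2) ^ multiplicity_at F (proj v, []) dvd
    eval3 const3 F (xyz $ 1 *s lift u + xyz $ 2 *s lift w)"
proof -
  let ?l = "const3 1 * xyz $ 1 + const3 (- a / b) * xyz $ 2"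
  have "xyz $ 1 *s lift u + xyz $ 2 *s lift w = (const3 (inverse b) * xyz $ 2) *s lift v + ?l *s lift u"
  proof (rule vec_eq_iff[THEN iffD2], rule allI)
    fix i
    have "w $ i = inverse b * (v $ i - a * u $ i)" using b by (simp add: v(2))
    then have cw: "const3 (w $ i) = const3 (inverse b) * (const3 (v $ i) - const3 a * const3 (u $ i))"
      by (simp add: unital_hom_mult[OF unital_hom_const3] unital_hom_diff[OF unital_hom_const3])
    have "- a / b = - (inverse b * a)" by (simp add: divide_inverse)
    then have ca: "const3 (- a / b) = - (const3 (inverse b) * const3 a)"
      by (simp only: unital_hom_mult[OF unital_hom_const3] unital_hom_minus[OF unital_hom_const3])
    show "(xyz $ 1 *s lift u + xyz $ 2 *s lift w) $ i =
        ((const3 (inverse b) * xyz $ 2) *s lift v + ?l *s lift u) $ i"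
      by (simp only: vector_add_component vector_smult_component lift_nth cw ca
          unital_hom_1[OF unital_hom_const3]) (simp add: algebra_simps)
  qed
  then show ?thesis by (simp only: proper_point_vanishing[OF F v(1)])
qed

lemma line_bound:
  assumes B: "irreducible_plane_curve B" and d: "curve_degree B \<ge> 2" and ind: "independent2 u w"
    and D: "homogeneous k D" "D dvd eval3 const3 B (xyz $ 1 *s lift u + xyz $ 2 *s lift w)"
  shows "k \<le> curve_degree B"
proof -
  obtain z where "\<not> (\<exists>a b. z = a *s u + b *s w)" using exists_outside_plane by blast
  then obtain A' where A': "with_columns u w z ** A' = mat 1" using with_columns_invertible[OF ind] by blast
  have "lift_mat (with_columns u w z) *v vector [xyz $ 1, xyz $ 2, 0] = xyz $ 1 *s lift u + xyz $ 2 *s lift w"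
    by (simp add: lift_with_columns)
  then show ?thesis using curve_restricted_to_line[OF B d A' D(1)] D(2) by simp
qed

text \<open>Its base points are the three coordinate points.\<close>

definition standard_involution :: "poly3 ^ 3" where
  "standard_involution = vector [xyz $ 2 * xyz $ 3, xyz $ 1 * xyz $ 3, xyz $ 1 * xyz $ 2]"

lemma standard_involution:
  "\<exists>a b c. a + b + c = 2 \<and> standard_involution $ i = power_product a b c xyz"
  "compose_map standard_involution standard_involution = power_product 1 1 1 xyz *s xyz"
proof -
  have "standard_involution $ 1 = power_product 0 1 1 xyz" "standard_involution $ 2 = power_product 1 0 1 xyz"
    "standard_involution $ 3 = power_product 1 1 0 xyz"
    by (simp_all add: standard_involution_def power_product_def)
  moreover have "(0::nat) + 1 + 1 = 2" "(1::nat) + 0 + 1 = 2" "(1::nat) + 1 + 0 = 2" by simp_all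
  ultimately show "\<exists>a b c. a + b + c = 2 \<and> standard_involution $ i = power_product a b c xyz"
    using exhaust_3[of i] by metis
  show "compose_map standard_involution standard_involution = power_product 1 1 1 xyz *s xyz"
    by (simp add: vec_eq_iff forall_3 compose_map_nth standard_involution_def subst3_simps power_product_def mult_ac)
qed

text \<open>Its base points are \<open>(1 : 0 : 0)\<close>, the point infinitely near to it in
  the direction of \<open>(0 : 1 : 0)\<close>, and \<open>(0 : 0 : 1)\<close>.\<close>

definition tangent_involution :: "poly3 ^ 3" where
  "tangent_involution = vector [xyz $ 1 * xyz $ 3, xyz $ 2 * xyz $ 3, (xyz $ 2)\<^sup>2]"

lemma tangent_involution:
  "\<exists>a b c. a + b + c = 2 \<and> tangent_involution $ i = power_product a b c xyz"
  "compose_map tangent_involution tangent_involution = power_product 0 2 1 xyz *s xyz"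
proof -
  have "tangent_involution $ 1 = power_product 1 0 1 xyz" "tangent_involution $ 2 = power_product 0 1 1 xyz"
    "tangent_involution $ 3 = power_product 0 2 0 xyz"
    by (simp_all add: tangent_involution_def power_product_def)
  moreover have "(0::nat) + 1 + 1 = 2" "(1::nat) + 0 + 1 = 2" "(0::nat) + 2 + 0 = 2" by simp_all
  ultimately show "\<exists>a b c. a + b + c = 2 \<and> tangent_involution $ i = power_product a b c xyz"
    using exhaust_3[of i] by metis
  show "compose_map tangent_involution tangent_involution = power_product 0 2 1 xyz *s xyz"
    by (simp add: vec_eq_iff forall_3 compose_map_nth tangent_involution_def subst3_simps power_product_def
        power2_eq_square mult_ac)
qed

text \<open>If the points lie on a line, the restriction of \<open>B\<close> to it has more
  zeros than its degree \<open>d\<close> allows. Otherwise the standard quadratic map based at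
  them applies: the total transform of \<open>B\<close> contains the exceptional line of each
  base point with at least the multiplicity of that point.\<close>

lemma degree_lowered_at_proper_points:
  assumes CB: "cremona_equivalent C B" and d: "curve_degree B \<ge> 2"
    and P: "P \<noteq> Q" "P \<noteq> R" "Q \<noteq> R"
    and sum: "multiplicity_at B (P, []) + multiplicity_at B (Q, []) + multiplicity_at B (R, []) > curve_degree B"
      (is "?p + ?q + ?r > _")
  shows "\<exists>B'. cremona_equivalent C B' \<and> curve_degree B' < curve_degree B"
proof -
  have B: "irreducible_plane_curve B" using CB by (rule cremona_equivalentE)
  obtain d where hom: "homogeneous d B" using B by (rule irreducible_plane_curveE)
  obtain u where u: "u \<noteq> 0" "P = proj u" by (rule proj_surj)
  obtain v where v: "v \<noteq> 0" "Q = proj v" by (rule proj_surj)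
  obtain w where w: "w \<noteq> 0" "R = proj w" by (rule proj_surj)
  have ind: "independent2 u v" using distinct_points_independent P(1) u v by simp
  show ?thesis
  proof (cases "\<exists>a b. w = a *s u + b *s v")
    case True
    then obtain a b where ab: "w = a *s u + b *s v" by blast
    have b: "b \<noteq> 0" using ab P(2) proj_eq_iff[OF u(1) w(1)] u(2) w(2) by auto
    have a: "a \<noteq> 0" using ab P(3) proj_eq_iff[OF v(1) w(1)] v(2) w(2) by auto
    let ?l = "const3 1 * xyz $ 1 + const3 (- a / b) * xyz $ 2"
    let ?F = "eval3 const3 B (xyz $ 1 *s lift u + xyz $ 2 *s lift v)"
    have l: "?l ^ ?r dvd ?F" using line_third_point[OF hom w(1) ab b] w(2) by simp
    have x: "xyz $ 2 ^ ?p dvd ?F"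
      using proper_point_vanishing[OF hom u(1), of "xyz $ 2" "xyz $ 1"] u(2) by simp
    have y: "xyz $ 1 ^ ?q dvd ?F"
      using proper_point_vanishing[OF hom v(1), of "xyz $ 1" "xyz $ 2" "lift u"] v(2)
      by (simp add: add.commute)
    have n1: "\<not> xyz $ 1 dvd ?l" using dvd_imp_vanishes[of "xyz $ 1" ?l "axis 2 1"] a b
      by (auto simp: value_at_simps axis_def)
    have n2: "\<not> xyz $ 2 dvd ?l" using dvd_imp_vanishes[of "xyz $ 2" ?l "axis 1 1"]
      by (auto simp: value_at_simps axis_def)
    have cop: "coprime (xyz $ 1) (xyz $ 2)" "coprime (xyz $ 1) ?l" "coprime (xyz $ 2) ?l"
      by (intro prime_elem_imp_coprime xyz_prime n1 n2 xyz_not_dvd; simp)+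
    have "xyz $ 2 ^ ?p * xyz $ 1 ^ ?q * ?l ^ ?r dvd ?F"
      using l x y cop by (intro divides_mult) (simp_all add: coprime_mult_left_iff coprime_commute)
    moreover have "homogeneous (?p * 1 + ?q * 1 + ?r * 1) (xyz $ 2 ^ ?p * xyz $ 1 ^ ?q * ?l ^ ?r)"
      by (intro homogeneous_mult homogeneous_power homogeneous_xyz homogeneous_linear2)
    ultimately have "?p * 1 + ?q * 1 + ?r * 1 \<le> curve_degree B"
      using line_bound[OF B d ind] by blast
    then show ?thesis using sum by simp
  next
    case False
    then obtain A' where A': "with_columns u v w ** A' = mat 1" using with_columns_invertible[OF ind] by blast
    let ?\<theta> = "lift_mat (with_columns u v w) *v standard_involution"
    \<comment> \<open>On each coordinate line the map takes the constant value \<open>u\<close>, \<open>v\<close> or \<open>w\<close>.\<close>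
    have e1: "?\<theta> = (xyz $ 2 * xyz $ 3) *s lift u + xyz $ 1 *s (xyz $ 3 *s lift v + xyz $ 2 *s lift w)"
      and e2: "?\<theta> = (xyz $ 1 * xyz $ 3) *s lift v + xyz $ 2 *s (xyz $ 3 *s lift u + xyz $ 1 *s lift w)"
      and e3: "?\<theta> = (xyz $ 1 * xyz $ 2) *s lift w + xyz $ 3 *s (xyz $ 2 *s lift u + xyz $ 1 *s lift v)"
      by (simp_all add: lift_with_columns standard_involution_def vec_eq_iff algebra_simps)
    have "power_product ?p ?q ?r xyz dvd eval3 const3 B ?\<theta>"
    proof (rule power_product_dvd)
      show "xyz $ 1 ^ ?p dvd eval3 const3 B ?\<theta>" unfolding e1 u(2) by (rule proper_point_vanishing[OF hom u(1)])
      show "xyz $ 2 ^ ?q dvd eval3 const3 B ?\<theta>" unfolding e2 v(2) by (rule proper_point_vanishing[OF hom v(1)])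
      show "xyz $ 3 ^ ?r dvd eval3 const3 B ?\<theta>" unfolding e3 w(2) by (rule proper_point_vanishing[OF hom w(1)])
    qed
    from quadratic_reduction[OF CB d standard_involution A' this sum] show ?thesis .
  qed
qed

text \<open>The same argument when one of the base points is infinitely near to another; the
  three points are on a line if the direction \<open>D\<close> points from \<open>P\<close> to
  \<open>Q\<close>.\<close>

lemma degree_lowered_at_tangent_direction:
  assumes CB: "cremona_equivalent C B" and d: "curve_degree B \<ge> 2" and P: "P \<noteq> Q"
    and sum: "multiplicity_at B (P, []) + multiplicity_at B (P, [D]) + multiplicity_at B (Q, []) > curve_degree B"
      (is "?p + ?q + ?r > _")
  shows "\<exists>B'. cremona_equivalent C B' \<and> curve_degree B' < curve_degree B"
proof -
  have B: "irreducible_plane_curve B" using CB by (rule cremona_equivalentE)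
  obtain d where hom: "homogeneous d B" using B by (rule irreducible_plane_curveE)
  obtain u where u: "u \<noteq> 0" "P = proj u" by (rule proj_surj)
  obtain w where w: "w \<noteq> 0" "Q = proj w" by (rule proj_surj)
  obtain \<delta> where ind: "independent2 u \<delta>" and near: "\<And>x \<rho> \<kappa> \<eta>. x ^ (?p + ?q) dvd
      eval3 const3 B (\<rho> *s lift u + (x * \<kappa>) *s lift \<delta> + x\<^sup>2 *s \<eta>)"
    using near_point_vanishing[OF hom u(1), of D] u(2) by auto
  show ?thesis
  proof (cases "\<exists>a b. w = a *s u + b *s \<delta>")
    case True
    then obtain a b where ab: "w = a *s u + b *s \<delta>" by blast
    have b: "b \<noteq> 0" using ab P proj_eq_iff[OF u(1) w(1)] u(2) w(2) by auto
    let ?l = "const3 1 * xyz $ 1 + const3 (- a / b) * xyz $ 2"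
    let ?F = "eval3 const3 B (xyz $ 1 *s lift u + xyz $ 2 *s lift \<delta>)"
    have l: "?l ^ ?r dvd ?F" using line_third_point[OF hom w(1) ab b] w(2) by simp
    have x: "xyz $ 2 ^ (?p + ?q) dvd ?F"
      using near[of "xyz $ 2" "xyz $ 1" 1 0] by simp
    have n2: "\<not> xyz $ 2 dvd ?l" using dvd_imp_vanishes[of "xyz $ 2" ?l "axis 1 1"]
      by (auto simp: value_at_simps axis_def)
    have "xyz $ 2 ^ (?p + ?q) * ?l ^ ?r dvd ?F" by (rule coprime_powers_dvd[OF xyz_prime n2 x l])
    moreover have "homogeneous ((?p + ?q) * 1 + ?r * 1) (xyz $ 2 ^ (?p + ?q) * ?l ^ ?r)"
      by (intro homogeneous_mult homogeneous_power homogeneous_xyz homogeneous_linear2)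
    ultimately have "(?p + ?q) * 1 + ?r * 1 \<le> curve_degree B"
      using line_bound[OF B d ind] by blast
    then show ?thesis using sum by simp
  next
    case False
    then obtain A' where A': "with_columns u \<delta> w ** A' = mat 1" using with_columns_invertible[OF ind] by blast
    let ?\<theta> = "lift_mat (with_columns u \<delta> w) *v tangent_involution"
    \<comment> \<open>Near the line \<open>y = 0\<close> the map approaches \<open>u\<close> in the direction \<open>\<delta>\<close>.\<close>
    have e2: "?\<theta> = (xyz $ 1 * xyz $ 3) *s lift u + (xyz $ 2 * xyz $ 3) *s lift \<delta> + (xyz $ 2)\<^sup>2 *s lift w"
      and e3: "?\<theta> = (xyz $ 2)\<^sup>2 *s lift w + xyz $ 3 *s (xyz $ 1 *s lift u + xyz $ 2 *s lift \<delta>)"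
      by (simp_all add: lift_with_columns tangent_involution_def vec_eq_iff algebra_simps)
    have "power_product 0 (?p + ?q) ?r xyz dvd eval3 const3 B ?\<theta>"
    proof (rule power_product_dvd)
      show "xyz $ 1 ^ 0 dvd eval3 const3 B ?\<theta>" by simp
      show "xyz $ 2 ^ (?p + ?q) dvd eval3 const3 B ?\<theta>" unfolding e2 by (rule near)
      show "xyz $ 3 ^ ?r dvd eval3 const3 B ?\<theta>" unfolding e3 w(2) by (rule proper_point_vanishing[OF hom w(1)])
    qed
    moreover have "0 + (?p + ?q) + ?r > curve_degree B" using sum by simp
    ultimately show ?thesis by (rule quadratic_reduction[OF CB d tangent_involution A'])
  qed
qed

section \<open>Choice of base points\<close>

text \<open>Multiplicities do not increase from a point to one infinitely near to it. Replacing
  points by points below them, one may take \<open>P\<close> as one of the three points and let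
  the other two be proper or in the first neighbourhood of \<open>P\<close>. If the larger of
  these two, \<open>x\<close>, is near \<open>P\<close>, it alone has more than half of what is
  missing to \<open>d\<close> beside \<open>P\<close>, and the point \<open>Q\<close>
  contributes the other half. If both lie above the same proper point \<open>R \<noteq>
  P\<close>, then \<open>R\<close> and a point in its first neighbourhood replace them.\<close>

lemma base_points_of_reduction:
  fixes m :: "near_point \<Rightarrow> nat"
  assumes mono: "\<And>p ds es. m (p, ds @ es) \<le> m (p, ds)"
    and max: "\<And>q. m q \<le> m (P, [])"
    and Q: "Q \<noteq> P" "d \<le> m (P, []) + 2 * m (Q, [])"
    and abc: "a \<noteq> b" "a \<noteq> c" "b \<noteq> c" "d < m a + m b + m c"
  shows "(\<exists>R S. R \<noteq> P \<and> S \<noteq> P \<and> R \<noteq> S \<and> d < m (P, []) + m (R, []) + m (S, [])) \<or>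
    (\<exists>R D S. R \<noteq> S \<and> d < m (R, []) + m (R, [D]) + m (S, []))" (is "?three \<or> ?tangent")
proof -
  have "\<exists>b c. b \<noteq> c \<and> b \<noteq> (P, []) \<and> c \<noteq> (P, []) \<and> d < m (P, []) + m b + m c"
  proof -
    consider "a = (P, [])" | "b = (P, [])" | "c = (P, [])" | "a \<noteq> (P, [])" "b \<noteq> (P, [])" by blast
    then show ?thesis
    proof cases
      case 1 then show ?thesis using abc by (intro exI[of _ b] exI[of _ c]) auto
    next
      case 2 then show ?thesis using abc by (intro exI[of _ a] exI[of _ c]) auto
    next
      case 3 then show ?thesis using abc by (intro exI[of _ a] exI[of _ b]) auto
    next
      case 4 then show ?thesis using abc max[of c] by (intro exI[of _ a] exI[of _ b]) auto
    qed
  qed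
  then obtain x y where xy: "x \<noteq> y" "x \<noteq> (P, [])" "y \<noteq> (P, [])" "d < m (P, []) + m x + m y" "m y \<le> m x"
    by (metis add.assoc add.commute nat_le_linear)
  \<comment> \<open>The proper point, and the point of its first neighbourhood, below a given point.\<close>
  have base: "m z \<le> m (fst z, [])" for z
    using mono[of "fst z" "[]" "snd z"] by simp
  have first: "\<exists>D. m z \<le> m (fst z, [D])" if ne: "snd z \<noteq> []" for z
  proof -
    obtain D ds where "snd z = [D] @ ds" using ne by (cases "snd z") auto
    then show ?thesis using mono[of "fst z" "[D]" ds] by (metis prod.collapse)
  qed
  consider "fst x = P" | "fst x \<noteq> P" "fst y = P" | "fst x \<noteq> P" "fst y \<noteq> P" "fst x \<noteq> fst y"
    | "fst x \<noteq> P" "fst x = fst y" by blast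
  then show ?thesis
  proof cases
    case 1
    then obtain D where "m x \<le> m (P, [D])" using first[of x] xy(2) by (metis prod.collapse)
    then have "d < m (P, []) + m (P, [D]) + m (Q, [])" using xy(4,5) Q(2) by linarith
    then show ?thesis using Q(1) by (intro disjI2 exI[of _ P] exI[of _ D] exI[of _ Q]) simp
  next
    case 2
    then obtain D where "m y \<le> m (P, [D])" using first[of y] xy(3) by (metis prod.collapse)
    then have "d < m (P, []) + m (P, [D]) + m (fst x, [])" using xy(4) base[of x] by linarith
    then show ?thesis using 2 by (intro disjI2 exI[of _ P] exI[of _ D] exI[of _ "fst x"]) simp
  next
    case 3
    then show ?thesis using xy(4) base[of x] base[of y] by (intro disjI1 exI[of _ "fst x"] exI[of _ "fst y"]) auto
  next
    case 4
    have "snd x \<noteq> [] \<or> snd y \<noteq> []" using 4 xy(1) by (metis prod.collapse)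
    then obtain D where "d < m (P, []) + m (fst x, []) + m (fst x, [D])"
    proof
      assume "snd x \<noteq> []"
      then obtain D where "m x \<le> m (fst x, [D])" using first by blast
      then have "d < m (P, []) + m (fst x, []) + m (fst x, [D])" using xy(4) base[of y] 4 by simp
      then show thesis by (rule that)
    next
      assume "snd y \<noteq> []"
      then obtain D where "m y \<le> m (fst x, [D])" using first 4 by metis
      then have "d < m (P, []) + m (fst x, []) + m (fst x, [D])" using xy(4) base[of x] by simp
      then show thesis by (rule that)
    qed
    then have "d < m (fst x, []) + m (fst x, [D]) + m (P, [])" by simp
    then show ?thesis using 4(1) by (intro disjI2 exI[of _ "fst x"] exI[of _ D] exI[of _ P]) simp
  qed
qed

lemma infinite_near_points: "infinite (UNIV :: near_point set)"
proof
  assume "finite (UNIV :: near_point set)"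
  moreover have "inj (\<lambda>ds. (undefined, ds) :: near_point)" by (rule injI) simp
  ultimately have "finite (UNIV :: direction list set)" by (meson finite_imageD finite_subset subset_UNIV)
  then show False using infinite_UNIV_listI by blast
qed

text \<open>Lists with fewer than three points are completed by arbitrary further points, which
  do not make the sum smaller.\<close>

lemma three_distinct_points:
  fixes m :: "near_point \<Rightarrow> nat"
  assumes "distinct qs"
  shows "\<exists>a b c. a \<noteq> b \<and> a \<noteq> c \<and> b \<noteq> c \<and> sum_list (take 3 (map m qs)) \<le> m a + m b + m c"
proof -
  note new = ex_new_if_finite[OF infinite_near_points]
  consider "qs = []" | a where "qs = [a]" | a b where "qs = [a, b]" | a b c rs where "qs = a # b # c # rs"
    by (metis list.exhaust)
  then show ?thesis
  proof cases
    case 1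
    fix a :: near_point
    obtain b where b: "b \<notin> {a}" using new[of "{a}"] by auto
    obtain c where c: "c \<notin> {a, b}" using new[of "{a, b}"] by auto
    show ?thesis using 1 b c by (intro exI[of _ a] exI[of _ b] exI[of _ c]) auto
  next
    case (2 a)
    obtain b where b: "b \<notin> {a}" using new[of "{a}"] by auto
    obtain c where c: "c \<notin> {a, b}" using new[of "{a, b}"] by auto
    show ?thesis using 2 b c by (intro exI[of _ a] exI[of _ b] exI[of _ c]) auto
  next
    case (3 a b)
    obtain c where c: "c \<notin> {a, b}" using new[of "{a, b}"] by auto
    show ?thesis using 3 c assms by (intro exI[of _ a] exI[of _ b] exI[of _ c]) auto
  next
    case (4 a b c rs)
    then show ?thesis using assms by (intro exI[of _ a] exI[of _ b] exI[of _ c]) (auto simp: numeral_3_eq_3)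
  qed
qed

theorem theorem0p2:
  fixes C B :: poly3
  assumes "irreducible_plane_curve C"
    and "cremona_minimal_model C B"
  shows "curve_degree B = 1
    \<or> (\<forall>qs. distinct qs \<and> set qs \<subseteq> curve_points B \<and>
          sorted_wrt (\<ge>) (map (multiplicity_at B) qs) \<longrightarrow>
          curve_degree B \<ge> sum_list (take 3 (map (multiplicity_at B) qs)))
    \<or> (\<exists>p \<in> curve_points B.
          (\<forall>q \<in> curve_points B. multiplicity_at B q \<le> multiplicity_at B p) \<and>
          (\<forall>q \<in> curve_points B.
             real (multiplicity_at B q) \<ge> (real (curve_degree B) - real (multiplicity_at B p)) / 2
             \<longrightarrow> infinitely_near q p))"
proof (rule ccontr)
  let ?m = "multiplicity_at B" and ?d = "curve_degree B"
  assume neg: "\<not> ?thesis"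
  have CB: "cremona_equivalent C B"
    and minimal: "\<not> (\<exists>B'. cremona_equivalent C B' \<and> curve_degree B' < ?d)"
    using assms(2) by (auto simp: cremona_minimal_model_def not_less)
  have B: "irreducible_plane_curve B" using CB by (rule cremona_equivalentE)
  obtain d where dB: "d > 0" "homogeneous d B" "B \<noteq> 0" "?d = d" using B by (rule irreducible_plane_curveE)
  have d2: "?d \<ge> 2" using neg dB by auto
  have mono: "?m (p, ds @ es) \<le> ?m (p, ds)" for p ds es by (rule multiplicity_at_append_le[OF dB(2,3)])
  obtain qs where "distinct qs" "?d < sum_list (take 3 (map ?m qs))" using neg by (auto simp: not_le)
  then obtain a b c where abc: "a \<noteq> b" "a \<noteq> c" "b \<noteq> c" "?d < ?m a + ?m b + ?m c"
    using three_distinct_points[of qs ?m] by (meson less_le_trans)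
  obtain x where x: "\<And>q. ?m q \<le> ?m x"
    using ex_has_greatest_nat[of "\<lambda>_. True" undefined ?m "Suc d"]
      le_imp_less_Suc[OF multiplicity_at_le_degree[OF dB(2,3)]] by blast
  \<comment> \<open>The proper point below a point of maximal multiplicity has maximal multiplicity as well.\<close>
  define P where "P = fst x"
  have max: "?m q \<le> ?m (P, [])" for q
    using x[of q] mono[of P "[]" "snd x"] by (simp add: P_def)
  \<comment> \<open>Three multiplicities with sum greater than \<open>d\<close> are not all zero.\<close>
  have "(P, []) \<in> curve_points B"
    using abc(4) max[of a] max[of b] max[of c] by (auto simp: curve_points_def)
  then obtain q where q: "real (?m q) \<ge> (real ?d - real (?m (P, []))) / 2" "\<not> infinitely_near q (P, [])"
    using neg max by blast
  have "fst q \<noteq> P" using q(2) by (simp add: infinitely_near_def)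
  moreover have "?d \<le> ?m (P, []) + 2 * ?m (fst q, [])"
    using q(1) mono[of "fst q" "[]" "snd q"] by simp
  ultimately consider
      R S where "R \<noteq> P" "S \<noteq> P" "R \<noteq> S" "?d < ?m (P, []) + ?m (R, []) + ?m (S, [])"
    | R D S where "R \<noteq> S" "?d < ?m (R, []) + ?m (R, [D]) + ?m (S, [])"
    using base_points_of_reduction[of ?m P "fst q" ?d a b c, OF mono max _ _ abc] by blast
  then show False
  proof cases
    case 1
    then show False using degree_lowered_at_proper_points[OF CB d2 1(1,2)[symmetric] 1(3,4)] minimal by blast
  next
    case 2
    then show False using degree_lowered_at_tangent_direction[OF CB d2 2] minimal by blast
  qed
qed

end
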